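(* For every $a\in\mathbb{R}$ and $b\in\mathbb{R}\setminus\{0\}$, $$\mathbb{P}\big(S(t)\le a+bt\ \text{for all } t\in[0,1]\big)=\Phi(a+b)\Phi(a)-\frac{1}{b}\phi(a)\Phi(a+b)+\frac{\sqrt{2\pi}}{b}\,\phi(a)\phi(b)\Phi(a)\,e^{-ab}.$$
   Context: $S(t)=B(t+1)-B(t)$, $t\in[0,1]$, where $B$ is a standard Brownian motion (the Slepian process). $\phi(x)=\frac{1}{\sqrt{2\pi}}e^{-x^2/2}$ is the standard normal density and $\Phi(x)=\int_{-\infty}^x\phi(s)\,ds$ the standard normal distribution function. *)

theory Defs
  imports "HOL-Probability.Probability"
begin

definition phi :: "real \<Rightarrow> real" where
  "phi x = exp (- (x^2) / 2) / sqrt (2 * pi)"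

definition Phi :: "real \<Rightarrow> real" where
  "Phi x = (LINT s:{..x}|lborel. phi s)"

definition std_brownian_motion :: "'a measure \<Rightarrow> (real \<Rightarrow> 'a \<Rightarrow> real) \<Rightarrow> bool" where
  "std_brownian_motion M B \<longleftrightarrow>
     prob_space M \<and>
     (\<forall>t\<ge>0. B t \<in> borel_measurable M) \<and>
     (AE \<omega> in M. B 0 \<omega> = 0) \<and>
     (\<forall>\<omega>\<in>space M. continuous_on {0..} (\<lambda>t. B t \<omega>)) \<and>
     (\<forall>s t. 0 \<le> s \<longrightarrow> s < t \<longrightarrow>
        distributed M lborel (\<lambda>\<omega>. B t \<omega> - B s \<omega>) (normal_density 0 (sqrt (t - s)))) \<and>
     (\<forall>(n::nat) (ts::nat \<Rightarrow> real). 0 \<le> ts 0 \<and> (\<forall>i<n. ts i < ts (Suc i)) \<longrightarrow>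
        prob_space.indep_vars M (\<lambda>_. borel) (\<lambda>i \<omega>. B (ts (Suc i)) \<omega> - B (ts i) \<omega>) {..<n})"

end

theory Submission
  imports Defs
begin

text \<open>
  Write $S(t) = (Y - X(1))/2 + X(t)$ with $X(t) = B(1+t) - B(1) - B(t)$ and $Y = B(2)$, which are
  independent. The gap $D(t) = a + bt - S(t)$ is, given its endpoints, a Brownian bridge of
  variance 2; hence its law is that of $u + X$, with $u$ distributed according to Lebesgue measure,
  weighted by a function of the two endpoints only. The reflection principle for $X$ (on dyadic
  grids, where the overshoot vanishes in the limit by path continuity) then gives the probability
  of no crossing as the integral over $u, v \<ge> 0$ of
  $\<phi>(a-u)\<phi>(a+b-v)(1 - e^{-uv})$, which is evaluated with the substitution $s = u + v$.
\<close>

text \<open>S is not Markov, so a first-passage reflection cannot be run on it directly.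
  \<open>X\<close>, being S - S(0), has independent symmetric steps on every grid, and those may be
  reflected. Its independence of Y rests on one Gaussian fact: the increments of B over the cells
  starting at i/N and at 1 + i/N are independent with equal variance, so their difference (a step of
  X) is independent of their sum (a part of Y). Lebesgue measure enters because Y has a density:
  given X, the starting gap u = a - S(0) is an affine function of Y. Removing the drift b by a
  change of measure leaves a factor that sees the path only through its endpoints u and v. The
  product phi(a-u) phi(a+b-v) appears because S(0) and S(1) are increments of B over disjoint unit
  intervals. Reflection replaces the displacement v - u by -v - u in the N(0,2) density, and the two
  values have quotient exp(-((u+v)^2 - (v-u)^2)/4) = exp(-uv). Integrals are taken in
  \<open>ennreal\<close>, so each subtraction needs its own finiteness or ordering argument.\<close>

section \<open>Gaussian rotations and independence of difference and sum\<close>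

lemma (in prob_space) distr_borel_eq_density:
  assumes "distributed M lborel X f"
  shows "distr M borel X = density lborel f"
proof -
  have "distr M borel X = distr M lborel X" by (rule distr_cong) auto
  also have "\<dots> = density lborel f" using assms by (rule distributed_distr_eq_density)
  finally show ?thesis .
qed

text \<open>With x = (s-d)/2 and y = (s+d)/2 one has x^2 + y^2 = (s^2 + d^2)/2, so the exponent
  separates in d and s. The factor 1/2 is the Jacobian of (x, y) -> (y - x, y + x).\<close>

lemma normal_density_rotation:
  assumes "0 < \<sigma>"
  shows "normal_density 0 \<sigma> ((s - d) / 2) * normal_density 0 \<sigma> ((s + d) / 2) / 2 =
    normal_density 0 (sqrt 2 * \<sigma>) d * normal_density 0 (sqrt 2 * \<sigma>) s"
proof -
  have e: "exp (- (((s - d) / 2)\<^sup>2) / (2 * \<sigma>\<^sup>2)) * exp (- (((s + d) / 2)\<^sup>2) / (2 * \<sigma>\<^sup>2)) =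
    exp (- d\<^sup>2 / (2 * (sqrt 2 * \<sigma>)\<^sup>2)) * exp (- s\<^sup>2 / (2 * (sqrt 2 * \<sigma>)\<^sup>2))"
    unfolding exp_add[symmetric] using assms
    by (intro arg_cong[where f=exp]) (simp add: field_simps power_mult_distrib power2_eq_square)
  have c: "1 / sqrt (2 * pi * \<sigma>\<^sup>2) * (1 / sqrt (2 * pi * \<sigma>\<^sup>2)) / 2 =
    1 / sqrt (2 * pi * (sqrt 2 * \<sigma>)\<^sup>2) * (1 / sqrt (2 * pi * (sqrt 2 * \<sigma>)\<^sup>2))"
    using assms by (simp add: field_simps power_mult_distrib)
  show ?thesis
    unfolding normal_density_def using arg_cong2[OF e c, of "(*)"] by (simp add: mult_ac)
qed

text \<open>The equal variances make the mixed term in the joint density vanish. The joint law is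
  computed by two one-dimensional substitutions, y = x + d at fixed x and then x = (s-d)/2 at fixed
  d; independence is read off from the resulting product density.\<close>

lemma (in prob_space) indep_normal_rotation:
  assumes ind: "indep_var borel X borel Y" and \<sigma>: "0 < \<sigma>"
    and X: "distributed M lborel X (normal_density 0 \<sigma>)"
    and Y: "distributed M lborel Y (normal_density 0 \<sigma>)"
  shows "distributed M lborel (\<lambda>\<omega>. Y \<omega> - X \<omega>) (normal_density 0 (sqrt 2 * \<sigma>))"
    and "distributed M lborel (\<lambda>\<omega>. Y \<omega> + X \<omega>) (normal_density 0 (sqrt 2 * \<sigma>))"
    and "indep_var borel (\<lambda>\<omega>. Y \<omega> - X \<omega>) borel (\<lambda>\<omega>. Y \<omega> + X \<omega>)"
proof -
  have s2: "sqrt (2 * \<sigma>\<^sup>2) = sqrt 2 * \<sigma>"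
    using \<sigma> by (simp add: real_sqrt_mult)
  show D: "distributed M lborel (\<lambda>\<omega>. Y \<omega> - X \<omega>) (normal_density 0 (sqrt 2 * \<sigma>))"
    using normal_density_affine[OF diff_indep_normal[OF ind \<sigma> \<sigma> X Y], of "-1" 0] \<sigma> by (simp add: s2)
  show S: "distributed M lborel (\<lambda>\<omega>. Y \<omega> + X \<omega>) (normal_density 0 (sqrt 2 * \<sigma>))"
    using add_indep_normal[OF ind \<sigma> \<sigma> X Y] by (simp add: s2 add.commute)
  have [measurable]: "X \<in> borel_measurable M" "Y \<in> borel_measurable M"
    using ind by (blast dest: indep_var_rv1 indep_var_rv2)+
  have J: "distributed M (lborel \<Otimes>\<^sub>M lborel) (\<lambda>x. (X x, Y x))
      (\<lambda>(x, y). ennreal (normal_density 0 \<sigma> x) * ennreal (normal_density 0 \<sigma> y))"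
    by (rule distributed_joint_indep[OF _ _ X Y])
      (use ind in \<open>auto simp: sigma_finite_lborel indep_var_distribution_eq cong: distr_cong\<close>)
  let ?n = "normal_density 0 \<sigma>" and ?m = "normal_density 0 (sqrt 2 * \<sigma>)"
  have eq: "distr M (borel \<Otimes>\<^sub>M borel) (\<lambda>\<omega>. (Y \<omega> - X \<omega>, Y \<omega> + X \<omega>)) =
     density (lborel \<Otimes>\<^sub>M lborel) (\<lambda>(d, s). ennreal (?m d) * ennreal (?m s))"
    (is "?L = ?R")
  proof (rule measure_eqI)
    show sets_eq: "sets ?L = sets ?R"
      by (simp cong: sets_pair_measure_cong)
    fix A assume "A \<in> sets ?L"
    then have [measurable]: "A \<in> sets (borel \<Otimes>\<^sub>M borel)" by simp
    then have [measurable]: "A \<in> sets (lborel \<Otimes>\<^sub>M lborel)" by (simp cong: sets_pair_measure_cong)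
    have "emeasure ?L A = (\<integral>\<^sup>+\<omega>. indicator A (Y \<omega> - X \<omega>, Y \<omega> + X \<omega>) \<partial>M)"
      by (subst nn_integral_indicator[symmetric], simp, subst nn_integral_distr) auto
    also have "\<dots> = (\<integral>\<^sup>+\<omega>. (\<lambda>(x, y). indicator A (y - x, y + x)) (X \<omega>, Y \<omega>) \<partial>M)"
      by simp
    also have "\<dots> = (\<integral>\<^sup>+z. (\<lambda>(x, y). ennreal (?n x) * ennreal (?n y)) z * (\<lambda>(x, y). indicator A (y - x, y + x)) z \<partial>(lborel \<Otimes>\<^sub>M lborel))"
      by (subst distributed_nn_integral[OF J]) auto
    also have "\<dots> = (\<integral>\<^sup>+x. \<integral>\<^sup>+y. ennreal (?n x) * ennreal (?n y) * indicator A (y - x, y + x) \<partial>lborel \<partial>lborel)"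
      by (subst lborel.nn_integral_fst[symmetric]) auto
    also have "\<dots> = (\<integral>\<^sup>+x. \<integral>\<^sup>+d. ennreal (?n x) * ennreal (?n (x + d)) * indicator A (d, d + 2 * x) \<partial>lborel \<partial>lborel)"
    proof (rule nn_integral_cong)
      fix x :: real
      show "(\<integral>\<^sup>+y. ennreal (?n x) * ennreal (?n y) * indicator A (y - x, y + x) \<partial>lborel) =
        (\<integral>\<^sup>+d. ennreal (?n x) * ennreal (?n (x + d)) * indicator A (d, d + 2 * x) \<partial>lborel)"
        by (subst nn_integral_real_affine[where c=1 and t=x]) (auto simp: algebra_simps)
    qed
    also have "\<dots> = (\<integral>\<^sup>+d. \<integral>\<^sup>+x. ennreal (?n x) * ennreal (?n (x + d)) * indicator A (d, d + 2 * x) \<partial>lborel \<partial>lborel)"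
      by (rule lborel_pair.Fubini') auto
    also have "\<dots> = (\<integral>\<^sup>+d. \<integral>\<^sup>+s. ennreal (?m d) * ennreal (?m s) * indicator A (d, s) \<partial>lborel \<partial>lborel)"
    proof (rule nn_integral_cong)
      fix d :: real
      have "(\<integral>\<^sup>+x. ennreal (?n x) * ennreal (?n (x + d)) * indicator A (d, d + 2 * x) \<partial>lborel) =
        ennreal \<bar>1/2\<bar> * (\<integral>\<^sup>+s. ennreal (?n (-d/2 + 1/2 * s)) * ennreal (?n ((-d/2 + 1/2 * s) + d)) * indicator A (d, d + 2 * (-d/2 + 1/2 * s)) \<partial>lborel)"
        by (subst nn_integral_real_affine[where c="1/2" and t="-d/2"]) auto
      also have "\<dots> = (\<integral>\<^sup>+s. ennreal (1/2) * (ennreal (?n (-d/2 + 1/2 * s)) * ennreal (?n ((-d/2 + 1/2 * s) + d)) * indicator A (d, d + 2 * (-d/2 + 1/2 * s))) \<partial>lborel)"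
        by (subst nn_integral_cmult) auto
      also have "\<dots> = (\<integral>\<^sup>+s. ennreal (?m d) * ennreal (?m s) * indicator A (d, s) \<partial>lborel)"
      proof (rule nn_integral_cong)
        fix s :: real
        have "ennreal (1/2) * (ennreal (?n (-d/2 + 1/2 * s)) * ennreal (?n ((-d/2 + 1/2 * s) + d)))
            = ennreal (?n ((s - d)/2) * ?n ((s + d)/2) / 2)"
        proof -
          have e: "-d/2 + 1/2 * s = (s - d)/2" "(s - d)/2 + d = (s + d)/2" by (simp_all add: field_simps)
          show ?thesis unfolding e
            by (subst ennreal_mult[symmetric], simp, simp, subst ennreal_mult[symmetric]) auto
        qed
        also have "\<dots> = ennreal (?m d) * ennreal (?m s)"
          by (simp add: normal_density_rotation[OF \<sigma>] ennreal_mult'')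
        finally show "ennreal (1/2) * (ennreal (?n (-d/2 + 1/2 * s)) * ennreal (?n ((-d/2 + 1/2 * s) + d)) * indicator A (d, d + 2 * (-d/2 + 1/2 * s)))
          = ennreal (?m d) * ennreal (?m s) * indicator A (d, s)"
          by (simp add: mult.assoc[symmetric])
      qed
      finally show "(\<integral>\<^sup>+x. ennreal (?n x) * ennreal (?n (x + d)) * indicator A (d, d + 2 * x) \<partial>lborel) = \<dots>" .
    qed
    also have "\<dots> = (\<integral>\<^sup>+z. (\<lambda>(d, s). ennreal (?m d) * ennreal (?m s)) z * indicator A z \<partial>(lborel \<Otimes>\<^sub>M lborel))"
      by (subst lborel.nn_integral_fst[symmetric]) auto
    also have "\<dots> = emeasure ?R A"
      by (subst emeasure_density) auto
    finally show "emeasure ?L A = emeasure ?R A" .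
  qed
  have m1: "0 < sqrt 2 * \<sigma>" using \<sigma> by simp
  interpret m: prob_space "density lborel ?m" by (rule prob_space_normal_density[OF m1])
  show "indep_var borel (\<lambda>\<omega>. Y \<omega> - X \<omega>) borel (\<lambda>\<omega>. Y \<omega> + X \<omega>)"
    unfolding indep_var_distribution_eq eq distr_borel_eq_density[OF D] distr_borel_eq_density[OF S]
    by (auto intro!: pair_measure_density sigma_finite_lborel m.sigma_finite_measure)
qed

text \<open>Independence across the pairs together with independence inside each pair makes all
  variables indexed by \<open>I \<times> UNIV\<close> (with a Boolean second index) independent.
  They can then be regrouped by the second index instead of the first.\<close>

lemma (in prob_space) indep_vars_pairs_imp_indep_var:
  fixes P Q :: "'i \<Rightarrow> 'a \<Rightarrow> real"
  assumes fin: "finite I" "I \<noteq> {}"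
    and ind: "indep_vars (\<lambda>_. borel \<Otimes>\<^sub>M borel) (\<lambda>i \<omega>. (P i \<omega>, Q i \<omega>)) I"
    and pq: "\<And>i. i \<in> I \<Longrightarrow> indep_var borel (P i) borel (Q i)"
  shows "indep_var (PiM I (\<lambda>_. borel)) (\<lambda>\<omega>. \<lambda>i\<in>I. P i \<omega>) (PiM I (\<lambda>_. borel)) (\<lambda>\<omega>. \<lambda>i\<in>I. Q i \<omega>)"
proof -
  define Z where "Z = (\<lambda>(i, c). if c then P i else Q i)"
  have [measurable]: "P i \<in> borel_measurable M" "Q i \<in> borel_measurable M" if "i \<in> I" for i
    using pq[OF that] by (blast dest: indep_var_rv1 indep_var_rv2)+
  have Z: "indep_vars (\<lambda>_. borel) Z (I \<times> UNIV)"
  proof (subst indep_vars_finite[where E="\<lambda>_. sets borel"])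
    show "\<forall>A\<in>I \<times> UNIV \<rightarrow> sets borel. prob (\<Inter>j\<in>I \<times> UNIV. Z j -` A j \<inter> space M) = (\<Prod>j\<in>I \<times> UNIV. prob (Z j -` A j \<inter> space M))"
    proof
      fix A :: "_ \<times> bool \<Rightarrow> real set" assume A: "A \<in> I \<times> UNIV \<rightarrow> sets borel"
      have "(\<Inter>j\<in>I \<times> UNIV. Z j -` A j \<inter> space M) =
         (\<Inter>i\<in>I. (\<lambda>\<omega>. (P i \<omega>, Q i \<omega>)) -` (A (i, True) \<times> A (i, False)) \<inter> space M)"
        using fin by (auto simp: Z_def UNIV_bool)
      also have "prob \<dots> = (\<Prod>i\<in>I. prob ((\<lambda>\<omega>. (P i \<omega>, Q i \<omega>)) -` (A (i, True) \<times> A (i, False)) \<inter> space M))"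
        using A fin by (intro indep_varsD[OF ind]) auto
      also have "\<dots> = (\<Prod>i\<in>I. \<Prod>c\<in>UNIV. prob (Z (i, c) -` A (i, c) \<inter> space M))"
      proof (intro prod.cong refl)
        fix i assume i: "i \<in> I"
        have "prob ((\<lambda>\<omega>. (P i \<omega>, Q i \<omega>)) -` (A (i, True) \<times> A (i, False)) \<inter> space M)
          = prob (P i -` A (i, True) \<inter> space M) * prob (Q i -` A (i, False) \<inter> space M)"
          using i A by (intro indep_varD[OF pq[OF i]]) auto
        then show "prob ((\<lambda>\<omega>. (P i \<omega>, Q i \<omega>)) -` (A (i, True) \<times> A (i, False)) \<inter> space M) = 
          (\<Prod>c\<in>UNIV. prob (Z (i, c) -` A (i, c) \<inter> space M))"
          by (simp add: UNIV_bool Z_def mult.commute)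
      qed
      also have "\<dots> = (\<Prod>j\<in>I \<times> UNIV. prob (Z j -` A j \<inter> space M))"
        using fin by (subst prod.cartesian_product) (auto intro!: prod.cong)
      finally show "prob (\<Inter>j\<in>I \<times> UNIV. Z j -` A j \<inter> space M) = (\<Prod>j\<in>I \<times> UNIV. prob (Z j -` A j \<inter> space M))" .
    qed
  qed (use fin in \<open>auto simp: Z_def split: if_splits simp: Int_stable_def sets.sigma_sets_eq[of borel, simplified]\<close>)
  have "indep_var (PiM (I \<times> {True}) (\<lambda>_. borel)) (\<lambda>\<omega>. restrict (\<lambda>j. Z j \<omega>) (I \<times> {True}))
     (PiM (I \<times> {False}) (\<lambda>_. borel)) (\<lambda>\<omega>. restrict (\<lambda>j. Z j \<omega>) (I \<times> {False}))"
    by (rule indep_var_restrict[OF Z]) auto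
  then have "indep_var (PiM I (\<lambda>_. borel)) ((\<lambda>f. \<lambda>i\<in>I. f (i, True)) \<circ> (\<lambda>\<omega>. restrict (\<lambda>j. Z j \<omega>) (I \<times> {True})))
     (PiM I (\<lambda>_. borel)) ((\<lambda>f. \<lambda>i\<in>I. f (i, False)) \<circ> (\<lambda>\<omega>. restrict (\<lambda>j. Z j \<omega>) (I \<times> {False})))"
    by (rule indep_var_compose) (auto intro!: measurable_restrict)
  then show ?thesis
    by (simp add: comp_def Z_def cong: restrict_cong)
qed

section \<open>Product densities, transfer of laws and the change of drift\<close>

lemma density_PiM:
  fixes f :: "'i \<Rightarrow> 'b \<Rightarrow> ennreal"
  assumes I: "finite I" and N: "\<And>i. sigma_finite_measure (N i)"
    and f[measurable]: "\<And>i. f i \<in> borel_measurable (N i)"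
    and D: "\<And>i. sigma_finite_measure (density (N i) (f i))"
  shows "density (PiM I N) (\<lambda>x. \<Prod>i\<in>I. f i (x i)) = PiM I (\<lambda>i. density (N i) (f i))"
proof -
  interpret N: product_sigma_finite N unfolding product_sigma_finite_def using N by blast
  interpret D: product_sigma_finite "\<lambda>i. density (N i) (f i)"
    unfolding product_sigma_finite_def using D by blast
  have m: "(\<lambda>x. \<Prod>i\<in>I. f i (x i)) \<in> borel_measurable (PiM I N)"
    by (intro borel_measurable_prod_ennreal) auto
  show ?thesis
  proof (rule D.PiM_eqI[OF I])
    show "sets (density (Pi\<^sub>M I N) (\<lambda>x. \<Prod>i\<in>I. f i (x i))) = sets (Pi\<^sub>M I (\<lambda>i. density (N i) (f i)))"
      by (simp cong: sets_PiM_cong)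
    fix A assume A: "\<And>i. i \<in> I \<Longrightarrow> A i \<in> sets (density (N i) (f i))"
    have "emeasure (density (Pi\<^sub>M I N) (\<lambda>x. \<Prod>i\<in>I. f i (x i))) (Pi\<^sub>E I A) =
      (\<integral>\<^sup>+x. (\<Prod>i\<in>I. f i (x i)) * indicator (Pi\<^sub>E I A) x \<partial>PiM I N)"
      using A I m by (intro emeasure_density) (auto intro!: sets_PiM_I_finite)
    also have "\<dots> = (\<integral>\<^sup>+x. (\<Prod>i\<in>I. f i (x i) * indicator (A i) (x i)) \<partial>PiM I N)"
    proof (rule nn_integral_cong)
      fix x assume x: "x \<in> space (PiM I N)"
      have "indicator (Pi\<^sub>E I A) x = (\<Prod>i\<in>I. indicator (A i) (x i) :: ennreal)"
      proof (cases "x \<in> Pi\<^sub>E I A")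
        case False
        then obtain i where "i \<in> I" "x i \<notin> A i" using x by (auto simp: space_PiM PiE_def)
        then have "(\<Prod>i\<in>I. indicator (A i) (x i) :: ennreal) = 0"
          using I by (intro prod_zero bexI[of _ i]) auto
        with False show ?thesis by simp
      next
        case True
        then have "(\<Prod>i\<in>I. indicator (A i) (x i) :: ennreal) = 1"
          by (intro prod.neutral) (auto simp: PiE_iff)
        with True show ?thesis by simp
      qed
      then show "(\<Prod>i\<in>I. f i (x i)) * indicator (Pi\<^sub>E I A) x = (\<Prod>i\<in>I. f i (x i) * indicator (A i) (x i))"
        by (simp add: prod.distrib)
    qed
    also have "\<dots> = (\<Prod>i\<in>I. \<integral>\<^sup>+x. f i x * indicator (A i) x \<partial>N i)"
      using A I by (intro N.product_nn_integral_prod) auto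
    also have "\<dots> = (\<Prod>i\<in>I. emeasure (density (N i) (f i)) (A i))"
      using A by (intro prod.cong refl emeasure_density[symmetric]) auto
    finally show "emeasure (density (Pi\<^sub>M I N) (\<lambda>x. \<Prod>i\<in>I. f i (x i))) (Pi\<^sub>E I A) = (\<Prod>i\<in>I. emeasure (density (N i) (f i)) (A i))" .
  qed
qed

lemma (in prob_space) indep_vars_imp_indep_var:
  assumes "indep_vars (\<lambda>_. N) X I" "i \<in> I" "j \<in> I" "i \<noteq> j"
  shows "indep_var N (X i) N (X j)"
proof -
  have "indep_var (PiM {i} (\<lambda>_. N)) (\<lambda>\<omega>. restrict (\<lambda>i. X i \<omega>) {i}) (PiM {j} (\<lambda>_. N)) (\<lambda>\<omega>. restrict (\<lambda>i. X i \<omega>) {j})"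
    using assms by (intro indep_var_restrict[OF assms(1)]) auto
  then have "indep_var N ((\<lambda>f. f i) \<circ> (\<lambda>\<omega>. restrict (\<lambda>i. X i \<omega>) {i})) N ((\<lambda>f. f j) \<circ> (\<lambda>\<omega>. restrict (\<lambda>i. X i \<omega>) {j}))"
    by (rule indep_var_compose) auto
  then show ?thesis by (simp add: comp_def)
qed

lemma (in prob_space) indep_var_commute:
  assumes "indep_var S X T Y" shows "indep_var T Y S X"
  using assms unfolding indep_var_eq indep_sets2_eq
  by (safe; subst Int_commute; subst mult.commute; blast)

lemma (in prob_space) indep_var_nn_integral:
  assumes ind: "indep_var S X T Y" and F[measurable]: "F \<in> borel_measurable (S \<Otimes>\<^sub>M T)"
  shows "(\<integral>\<^sup>+\<omega>. F (X \<omega>, Y \<omega>) \<partial>M) = (\<integral>\<^sup>+\<omega>. \<integral>\<^sup>+x. F (x, Y \<omega>) \<partial>distr M S X \<partial>M)"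
proof -
  have [measurable]: "X \<in> M \<rightarrow>\<^sub>M S" "Y \<in> M \<rightarrow>\<^sub>M T"
    using ind by (blast dest: indep_var_rv1 indep_var_rv2)+
  interpret X: prob_space "distr M S X" by (rule prob_space_distr) measurable
  interpret Y: prob_space "distr M T Y" by (rule prob_space_distr) measurable
  interpret XY: pair_sigma_finite "distr M S X" "distr M T Y" ..
  have "(\<integral>\<^sup>+\<omega>. F (X \<omega>, Y \<omega>) \<partial>M) = (\<integral>\<^sup>+z. F z \<partial>distr M (S \<Otimes>\<^sub>M T) (\<lambda>\<omega>. (X \<omega>, Y \<omega>)))"
    by (subst nn_integral_distr) auto
  also have "\<dots> = (\<integral>\<^sup>+z. F z \<partial>(distr M S X \<Otimes>\<^sub>M distr M T Y))"
    using ind by (simp add: indep_var_distribution_eq)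
  also have "\<dots> = (\<integral>\<^sup>+y. \<integral>\<^sup>+x. F (x, y) \<partial>distr M S X \<partial>distr M T Y)"
    by (subst XY.nn_integral_snd[symmetric]) (auto cong: measurable_cong_sets sets_pair_measure_cong)
  also have "\<dots> = (\<integral>\<^sup>+\<omega>. \<integral>\<^sup>+x. F (x, Y \<omega>) \<partial>distr M S X \<partial>M)"
    by (subst nn_integral_distr) (auto intro!: X.borel_measurable_nn_integral_fst)
  finally show ?thesis .
qed

lemma (in prob_space) indep_vars_same_law_nn_integral:
  assumes I: "I \<noteq> {}" and X: "indep_vars N X I" and Y: "indep_vars N Y I"
    and eq: "\<And>i. i \<in> I \<Longrightarrow> distr M (N i) (X i) = distr M (N i) (Y i)"
    and H[measurable]: "H \<in> borel_measurable (PiM I N)"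
  shows "(\<integral>\<^sup>+\<omega>. H (\<lambda>i\<in>I. X i \<omega>) \<partial>M) = (\<integral>\<^sup>+\<omega>. H (\<lambda>i\<in>I. Y i \<omega>) \<partial>M)"
proof -
  have mX[measurable]: "\<And>i. i \<in> I \<Longrightarrow> X i \<in> M \<rightarrow>\<^sub>M N i" using X by (auto simp: indep_vars_def)
  have mY[measurable]: "\<And>i. i \<in> I \<Longrightarrow> Y i \<in> M \<rightarrow>\<^sub>M N i" using Y by (auto simp: indep_vars_def)
  have "distr M (PiM I N) (\<lambda>\<omega>. \<lambda>i\<in>I. X i \<omega>) = distr M (PiM I N) (\<lambda>\<omega>. \<lambda>i\<in>I. Y i \<omega>)"
    using X Y eq by (simp add: indep_vars_iff_distr_eq_PiM'[OF I] cong: PiM_cong)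
  then have "(\<integral>\<^sup>+x. H x \<partial>distr M (PiM I N) (\<lambda>\<omega>. \<lambda>i\<in>I. X i \<omega>)) = (\<integral>\<^sup>+x. H x \<partial>distr M (PiM I N) (\<lambda>\<omega>. \<lambda>i\<in>I. Y i \<omega>))"
    by simp
  then show ?thesis
    by (subst (asm) (1 2) nn_integral_distr) auto
qed

text \<open>A discrete Cameron-Martin formula. By symmetry \<open>c - D i\<close> has law N(c,
  \<sigma>^2), whose density relative to N(0, \<sigma>^2) is the stated exponential, and densities
  multiply over coordinates. The form \<open>c - D i\<close> is chosen because the gap a + bt - S(t)
  moves by b/N minus a step of \<open>X\<close>.\<close>

lemma (in prob_space) gaussian_shift_nn_integral:
  fixes c :: real
  assumes I: "finite I" "I \<noteq> {}" and ind: "indep_vars (\<lambda>_. borel) D I" and \<sigma>: "0 < \<sigma>"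
    and nD: "\<And>i. i \<in> I \<Longrightarrow> distributed M lborel (D i) (normal_density 0 \<sigma>)"
    and H[measurable]: "H \<in> borel_measurable (PiM I (\<lambda>_. borel))"
  shows "(\<integral>\<^sup>+\<omega>. H (\<lambda>i\<in>I. c - D i \<omega>) \<partial>M) =
    (\<integral>\<^sup>+\<omega>. ennreal (exp (\<Sum>i\<in>I. c * D i \<omega> / \<sigma>\<^sup>2 - c\<^sup>2 / (2 * \<sigma>\<^sup>2))) * H (\<lambda>i\<in>I. D i \<omega>) \<partial>M)"
proof -
  have mD[measurable]: "\<And>i. i \<in> I \<Longrightarrow> D i \<in> borel_measurable M" using ind by (auto simp: indep_vars_def)
  let ?n = "\<lambda>i::'b. density lborel (normal_density 0 \<sigma>)"
  let ?r = "\<lambda>i x. ennreal (exp (c * x / \<sigma>\<^sup>2 - c\<^sup>2 / (2 * \<sigma>\<^sup>2)))"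
  have dens: "density (?n i) (?r i) = density lborel (normal_density c \<sigma>)" for i
    by (subst density_density_eq)
      (use \<sigma> in \<open>auto simp: normal_density_def ennreal_mult[symmetric] exp_add[symmetric]
        power2_eq_square field_simps intro!: density_cong arg_cong[where f=exp]\<close>)
  have "prob_space (density lborel (normal_density m \<sigma>))" for m
    by (rule prob_space_normal_density[OF \<sigma>])
  then have sf: "sigma_finite_measure (density lborel (normal_density m \<sigma>))" for m
    by (intro finite_measure.sigma_finite_measure prob_space.finite_measure)
  have indc: "indep_vars (\<lambda>_. borel) (\<lambda>i \<omega>. c - D i \<omega>) I"
    by (rule indep_vars_compose2[OF ind]) auto
  have "distr M (PiM I (\<lambda>_. borel)) (\<lambda>\<omega>. \<lambda>i\<in>I. c - D i \<omega>) = PiM I (\<lambda>i. distr M borel (\<lambda>\<omega>. c - D i \<omega>))"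
    using indc by (subst (asm) indep_vars_iff_distr_eq_PiM'[OF I(2)]) auto
  also have "\<dots> = PiM I (\<lambda>i. density (?n i) (?r i))"
  proof (intro PiM_cong refl)
    fix i assume i: "i \<in> I"
    show "distr M borel (\<lambda>\<omega>. c - D i \<omega>) = density (?n i) (?r i)"
      unfolding dens using normal_density_affine[OF nD[OF i] \<sigma>, of "-1" c]
      by (intro distr_borel_eq_density) simp
  qed
  also have "\<dots> = density (PiM I ?n) (\<lambda>x. \<Prod>i\<in>I. ?r i (x i))"
    by (rule density_PiM[symmetric]) (use I sf in \<open>auto simp: dens\<close>)
  also have "PiM I ?n = PiM I (\<lambda>i. distr M borel (D i))"
    using nD by (intro PiM_cong refl distr_borel_eq_density[symmetric]) auto
  also have "\<dots> = distr M (PiM I (\<lambda>_. borel)) (\<lambda>\<omega>. \<lambda>i\<in>I. D i \<omega>)"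
    using ind by (subst (asm) indep_vars_iff_distr_eq_PiM'[OF I(2)]) auto
  finally have eq: "distr M (PiM I (\<lambda>_. borel)) (\<lambda>\<omega>. \<lambda>i\<in>I. c - D i \<omega>) =
    density (distr M (PiM I (\<lambda>_. borel)) (\<lambda>\<omega>. \<lambda>i\<in>I. D i \<omega>)) (\<lambda>x. \<Prod>i\<in>I. ?r i (x i))" .
  have "(\<integral>\<^sup>+\<omega>. H (\<lambda>i\<in>I. c - D i \<omega>) \<partial>M) = (\<integral>\<^sup>+x. H x \<partial>distr M (PiM I (\<lambda>_. borel)) (\<lambda>\<omega>. \<lambda>i\<in>I. c - D i \<omega>))"
    by (subst nn_integral_distr) auto
  also have "\<dots> = (\<integral>\<^sup>+\<omega>. (\<Prod>i\<in>I. ?r i (D i \<omega>)) * H (\<lambda>i\<in>I. D i \<omega>) \<partial>M)"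
    unfolding eq by (subst nn_integral_density, measurable, subst nn_integral_distr) (auto cong: prod.cong)
  also have "\<dots> = (\<integral>\<^sup>+\<omega>. ennreal (exp (\<Sum>i\<in>I. c * D i \<omega> / \<sigma>\<^sup>2 - c\<^sup>2 / (2 * \<sigma>\<^sup>2))) * H (\<lambda>i\<in>I. D i \<omega>) \<partial>M)"
    using I by (simp add: prod_ennreal exp_sum)
  finally show ?thesis .
qed

section \<open>Brownian motion and the grid steps of X\<close>

locale brownian_motion =
  fixes M :: "'a measure" and B :: "real \<Rightarrow> 'a \<Rightarrow> real"
  assumes std_brownian_motion: "std_brownian_motion M B"
begin

sublocale prob_space M
  using std_brownian_motion by (simp add: std_brownian_motion_def)

lemma measurable_B[measurable]: "0 \<le> t \<Longrightarrow> B t \<in> borel_measurable M"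
  using std_brownian_motion by (simp add: std_brownian_motion_def)

lemma continuous_path: "\<omega> \<in> space M \<Longrightarrow> continuous_on {0..} (\<lambda>t. B t \<omega>)"
  using std_brownian_motion by (simp add: std_brownian_motion_def)

lemma increment_normal:
  "0 \<le> s \<Longrightarrow> s < t \<Longrightarrow> distributed M lborel (\<lambda>\<omega>. B t \<omega> - B s \<omega>) (normal_density 0 (sqrt (t - s)))"
  using std_brownian_motion by (simp add: std_brownian_motion_def)

lemma increments_indep:
  "0 \<le> ts 0 \<Longrightarrow> (\<And>i. i < n \<Longrightarrow> ts i < ts (Suc i)) \<Longrightarrow>
    indep_vars (\<lambda>_. borel) (\<lambda>i \<omega>. B (ts (Suc i)) \<omega> - B (ts i) \<omega>) {..<n}"
  using std_brownian_motion by (simp add: std_brownian_motion_def)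

text \<open>\<open>X\<close> has the law of \<open>sqrt 2\<close> times a Brownian motion and is independent of \<open>B 2 - B 0\<close>.\<close>

definition X :: "real \<Rightarrow> 'a \<Rightarrow> real" where
  "X t \<omega> = (B (1 + t) \<omega> - B 1 \<omega>) - (B t \<omega> - B 0 \<omega>)"

definition step :: "nat \<Rightarrow> nat \<Rightarrow> 'a \<Rightarrow> real" where
  "step N i \<omega> = X (Suc i / N) \<omega> - X (i / N) \<omega>"

text \<open>Subtracting \<open>B 0\<close> in \<open>X\<close> makes this hold for every path,
  whereas \<open>B 0\<close> itself vanishes only almost surely.\<close>

lemma X_0[simp]: "X 0 \<omega> = 0"
  by (simp add: X_def)

lemma measurable_X[measurable]: "0 \<le> t \<Longrightarrow> X t \<in> borel_measurable M"
  unfolding X_def[abs_def] by measurable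

lemma measurable_step[measurable]: "step N i \<in> borel_measurable M"
  unfolding step_def[abs_def] by measurable

lemma sum_step: "(\<Sum>i<k. step N i \<omega>) = X (k / N) \<omega>"
  unfolding step_def by (subst sum_lessThan_telescope[where f="\<lambda>i. X (i / N) \<omega>"]) simp

lemma continuous_X: "\<omega> \<in> space M \<Longrightarrow> continuous_on {0..1} (\<lambda>t. X t \<omega>)"
  unfolding X_def
  by (intro continuous_intros continuous_on_compose2[OF continuous_path[of \<omega>]]) auto

text \<open>All three facts come from pairing the i-th cell of [0,1] with the i-th cell of [1,2]:
  the difference of the two increments is a step of \<open>X\<close>, and the sums add up to
  \<open>B 2 - B 0\<close>.\<close>

lemma grid_steps:
  assumes N: "0 < N"
  shows step_indep: "indep_vars (\<lambda>_. borel) (step N) {..<N}"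
    and step_normal: "\<And>i. i < N \<Longrightarrow> distributed M lborel (step N i) (normal_density 0 (sqrt (2 / real N)))"
    and nn_integral_total_steps: "\<And>F. F \<in> borel_measurable (borel \<Otimes>\<^sub>M PiM {..<N} (\<lambda>_. borel)) \<Longrightarrow>
      (\<integral>\<^sup>+\<omega>. F (B 2 \<omega> - B 0 \<omega>, \<lambda>i\<in>{..<N}. step N i \<omega>) \<partial>M) =
      (\<integral>\<^sup>+\<omega>. \<integral>\<^sup>+y. ennreal (normal_density 0 (sqrt 2) y) * F (y, \<lambda>i\<in>{..<N}. step N i \<omega>) \<partial>lborel \<partial>M)"
proof -
  \<comment> \<open>The increments of B over the 2N cells of length 1/N in [0,2]; indices i and N +
    i belong to corresponding cells of the two halves.\<close>
  define \<xi> where "\<xi> i \<omega> = B (real (Suc i) / N) \<omega> - B (real i / N) \<omega>" for i \<omega>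
  have \<xi>: "indep_vars (\<lambda>_. borel) \<xi> {..<2 * N}"
    unfolding \<xi>_def[abs_def] using N
    by (intro increments_indep[where ts="\<lambda>i. real i / N"]) (auto simp: divide_simps)
  have n\<xi>: "distributed M lborel (\<xi> i) (normal_density 0 (sqrt (1 / real N)))" for i
  proof -
    have "real (Suc i) / N - real i / N = 1 / N" using N by (simp add: field_simps)
    then show ?thesis
      unfolding \<xi>_def[abs_def] using increment_normal[of "real i / N" "real (Suc i) / N"] N
      by (simp add: divide_strict_right_mono)
  qed
  have pair: "indep_var borel (\<xi> i) borel (\<xi> (N + i))" if "i < N" for i
    using that N by (intro indep_vars_imp_indep_var[OF \<xi>]) auto
  have \<sigma>: "0 < sqrt (1 / real N)" using N by simp
  have \<sigma>2: "sqrt 2 * sqrt (1 / real N) = sqrt (2 / real N)" by (simp add: real_sqrt_mult[symmetric])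
  have step: "step N i \<omega> = \<xi> (N + i) \<omega> - \<xi> i \<omega>" for i \<omega>
  proof -
    have "real (N + i) / N = 1 + i / N" "real (Suc (N + i)) / N = 1 + Suc i / N" using N by (simp_all add: field_simps)
    then show ?thesis by (simp add: step_def X_def \<xi>_def)
  qed
  note rot = indep_normal_rotation[OF pair \<sigma> n\<xi> n\<xi>]
  show "distributed M lborel (step N i) (normal_density 0 (sqrt (2 / real N)))" if "i < N" for i
    using rot(1)[OF that] unfolding step[abs_def] \<sigma>2 .
  \<comment> \<open>The companion of \<open>step N i\<close>: the rotation makes it independent of
    that step, and the blocks {i, N + i} are disjoint for different i.\<close>
  define Q where "Q i \<omega> = \<xi> (N + i) \<omega> + \<xi> i \<omega>" for i \<omega>
  have "indep_vars (\<lambda>i. PiM {i, N + i} (\<lambda>_. borel)) (\<lambda>i \<omega>. restrict (\<lambda>j. \<xi> j \<omega>) {i, N + i}) {..<N}"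
    by (rule indep_vars_restrict[OF \<xi>]) (auto simp: disjoint_family_on_def)
  then have "indep_vars (\<lambda>_. borel \<Otimes>\<^sub>M borel) (\<lambda>i \<omega>. (\<lambda>f. (f (N + i) - f i, f (N + i) + f i)) (restrict (\<lambda>j. \<xi> j \<omega>) {i, N + i})) {..<N}"
    by (rule indep_vars_compose2) auto
  then have PQ: "indep_vars (\<lambda>_. borel \<Otimes>\<^sub>M borel) (\<lambda>i \<omega>. (step N i \<omega>, Q i \<omega>)) {..<N}"
    by (simp add: step Q_def)
  then have "indep_vars (\<lambda>_. borel) (\<lambda>i \<omega>. fst (step N i \<omega>, Q i \<omega>)) {..<N}"
    by (rule indep_vars_compose2[where Y="\<lambda>_. fst"]) auto
  then show "indep_vars (\<lambda>_. borel) (step N) {..<N}" by simp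
  have "indep_var (PiM {..<N} (\<lambda>_. borel)) (\<lambda>\<omega>. \<lambda>i\<in>{..<N}. step N i \<omega>) (PiM {..<N} (\<lambda>_. borel)) (\<lambda>\<omega>. \<lambda>i\<in>{..<N}. Q i \<omega>)"
    by (rule indep_vars_pairs_imp_indep_var[OF _ _ PQ])
      (use N rot(3) in \<open>auto simp: step[abs_def] Q_def[abs_def]\<close>)
  \<comment> \<open>The order is exchanged because \<open>indep_var_nn_integral\<close> integrates
    out the first variable, which has to be the one carrying \<open>B 2 - B 0\<close>.\<close>
  then have QP: "indep_var (PiM {..<N} (\<lambda>_. borel)) (\<lambda>\<omega>. \<lambda>i\<in>{..<N}. Q i \<omega>) (PiM {..<N} (\<lambda>_. borel)) (\<lambda>\<omega>. \<lambda>i\<in>{..<N}. step N i \<omega>)"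
    by (rule indep_var_commute)
  \<comment> \<open>Both halves telescope together: the sum is (B 2 + B 1) - (B 1 + B 0).\<close>
  have Q: "(\<Sum>i<N. Q i \<omega>) = B 2 \<omega> - B 0 \<omega>" for \<omega>
  proof -
    have "(\<Sum>i<N. Q i \<omega>) = (\<Sum>i<N. (\<lambda>i. B (1 + i / N) \<omega> + B (i / N) \<omega>) (Suc i) - (\<lambda>i. B (1 + i / N) \<omega> + B (i / N) \<omega>) i)"
    proof (intro sum.cong refl)
      fix i
      have "real (N + i) / N = 1 + i / N" "real (Suc (N + i)) / N = 1 + Suc i / N" using N by (simp_all add: field_simps)
      then show "Q i \<omega> = (\<lambda>i. B (1 + i / N) \<omega> + B (i / N) \<omega>) (Suc i) - (\<lambda>i. B (1 + i / N) \<omega> + B (i / N) \<omega>) i"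
        by (simp add: Q_def \<xi>_def)
    qed
    also have "\<dots> = B 2 \<omega> - B 0 \<omega>"
      by (subst sum_lessThan_telescope) (use N in simp)
    finally show ?thesis .
  qed
  have [measurable]: "Q i \<in> borel_measurable M" for i
    unfolding Q_def[abs_def] \<xi>_def[abs_def] by measurable
  fix F :: "real \<times> (nat \<Rightarrow> real) \<Rightarrow> ennreal"
  assume [measurable]: "F \<in> borel_measurable (borel \<Otimes>\<^sub>M PiM {..<N} (\<lambda>_. borel))"
  let ?\<Delta> = "\<lambda>\<omega>. \<lambda>i\<in>{..<N}. step N i \<omega>"
  have nB: "distributed M lborel (\<lambda>\<omega>. B 2 \<omega> - B 0 \<omega>) (normal_density 0 (sqrt 2))"
    using increment_normal[of 0 2] by simp
  have \<Delta>[measurable]: "?\<Delta> \<in> M \<rightarrow>\<^sub>M PiM {..<N} (\<lambda>_. borel)"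
    by (intro measurable_restrict) auto
  have "(\<integral>\<^sup>+\<omega>. F (B 2 \<omega> - B 0 \<omega>, ?\<Delta> \<omega>) \<partial>M) =
    (\<integral>\<^sup>+\<omega>. (\<lambda>(q, d). F (\<Sum>i<N. q i, d)) (\<lambda>i\<in>{..<N}. Q i \<omega>, ?\<Delta> \<omega>) \<partial>M)"
    by (simp add: Q)
  also have "\<dots> = (\<integral>\<^sup>+\<omega>. \<integral>\<^sup>+q. F (\<Sum>i<N. q i, ?\<Delta> \<omega>) \<partial>distr M (PiM {..<N} (\<lambda>_. borel)) (\<lambda>\<omega>. \<lambda>i\<in>{..<N}. Q i \<omega>) \<partial>M)"
    by (subst indep_var_nn_integral[OF QP]) auto
  also have "\<dots> = (\<integral>\<^sup>+\<omega>. \<integral>\<^sup>+\<omega>'. F (B 2 \<omega>' - B 0 \<omega>', ?\<Delta> \<omega>) \<partial>M \<partial>M)"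
  proof (rule nn_integral_cong)
    fix \<omega> assume [measurable]: "\<omega> \<in> space M"
    have [measurable]: "?\<Delta> \<omega> \<in> space (PiM {..<N} (\<lambda>_. borel))"
      by (auto simp: space_PiM)
    show "(\<integral>\<^sup>+q. F (\<Sum>i<N. q i, ?\<Delta> \<omega>) \<partial>distr M (PiM {..<N} (\<lambda>_. borel)) (\<lambda>\<omega>. \<lambda>i\<in>{..<N}. Q i \<omega>)) =
      (\<integral>\<^sup>+\<omega>'. F (B 2 \<omega>' - B 0 \<omega>', ?\<Delta> \<omega>) \<partial>M)"
      by (subst nn_integral_distr) (auto simp: Q)
  qed
  also have "\<dots> = (\<integral>\<^sup>+\<omega>. \<integral>\<^sup>+y. ennreal (normal_density 0 (sqrt 2) y) * F (y, ?\<Delta> \<omega>) \<partial>lborel \<partial>M)"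
  proof (rule nn_integral_cong)
    fix \<omega> assume [measurable]: "\<omega> \<in> space M"
    have [measurable]: "?\<Delta> \<omega> \<in> space (PiM {..<N} (\<lambda>_. borel))"
      by (auto simp: space_PiM)
    show "(\<integral>\<^sup>+\<omega>'. F (B 2 \<omega>' - B 0 \<omega>', ?\<Delta> \<omega>) \<partial>M) = (\<integral>\<^sup>+y. ennreal (normal_density 0 (sqrt 2) y) * F (y, ?\<Delta> \<omega>) \<partial>lborel)"
      by (subst distributed_nn_integral[OF nB]) auto
  qed
  finally show "(\<integral>\<^sup>+\<omega>. F (B 2 \<omega> - B 0 \<omega>, ?\<Delta> \<omega>) \<partial>M) = \<dots>" .
qed

end

section \<open>The grid probability as a weighted integral over the starting gap\<close>

lemma measurable_partial_sum:
  fixes k N :: nat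
  assumes "k \<le> N"
  shows "(\<lambda>d. \<Sum>i<k. d i :: real) \<in> borel_measurable (PiM {..<N} (\<lambda>_. borel))"
  using assms by (intro borel_measurable_sum measurable_component_singleton) auto

text \<open>The density of $(a - S(0), a + b - S(1))$ at $(u, v)$ divided by the density at $v$ of a
  centred Gaussian walk of variance 2 started at $u$.\<close>

definition weight :: "real \<Rightarrow> real \<Rightarrow> real \<Rightarrow> real \<Rightarrow> real" where
  "weight a b u v = 2 * normal_density 0 (sqrt 2) (2 * a + b - u - v) * exp (b * (v - u) / 2 - b\<^sup>2 / 4)"

context brownian_motion
begin

text \<open>\<open>X t\<close> is S(t) - S(0), and (B 2 - B 0) - X 1 = 2 (B 1 - B 0), so the first
  summand is S(0).\<close>

lemma slepian_eq: "B (t + 1) \<omega> - B t \<omega> = ((B 2 \<omega> - B 0 \<omega>) - X 1 \<omega>) / 2 + X t \<omega>"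
  by (simp add: X_def add.commute field_simps)

text \<open>For a fixed path of \<open>X\<close> the only remaining randomness is Y, whose density
  is integrated in the variable u, the gap at time 0. After exchanging the integrals, u is a fixed
  starting point and the drift of the gap can be removed by tilting the law of the steps.\<close>

lemma grid_probability:
  assumes N: "0 < N"
  shows "emeasure M {\<omega> \<in> space M. \<forall>k\<in>{..N}. B (real k / real N + 1) \<omega> - B (real k / real N) \<omega> \<le> a + b * (real k / real N)} =
    (\<integral>\<^sup>+u. \<integral>\<^sup>+\<omega>. ennreal (weight a b u (u + X 1 \<omega>)) * indicator {\<omega>. \<forall>k\<in>{..N}. 0 \<le> u + X (real k / real N) \<omega>} \<omega> \<partial>M \<partial>lborel)"
proof -
  let ?P = "PiM {..<N} (\<lambda>_. borel) :: (nat \<Rightarrow> real) measure"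
  note measurable_partial_sum[measurable]
  define x :: "nat \<Rightarrow> (nat \<Rightarrow> real) \<Rightarrow> real" where "x k d = (\<Sum>i<k. d i)" for k d
  have x[measurable]: "k \<le> N \<Longrightarrow> x k \<in> borel_measurable ?P" for k
    unfolding x_def[abs_def] by measurable
  have x2[measurable]: "k \<in> {..N} \<Longrightarrow> x k \<in> borel_measurable ?P" for k
    by simp
  let ?\<Delta> = "\<lambda>\<omega>. \<lambda>i\<in>{..<N}. step N i \<omega>"
  let ?p = "normal_density 0 (sqrt 2)"
  have \<Delta>[measurable]: "?\<Delta> \<in> M \<rightarrow>\<^sub>M ?P"
    by (intro measurable_restrict) auto
  have xX: "x k (?\<Delta> \<omega>) = X (real k / real N) \<omega>" if "k \<le> N" for k \<omega>
    using that by (auto simp: x_def sum_step[symmetric] intro!: sum.cong)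
  have xN: "x N (?\<Delta> \<omega>) = X 1 \<omega>" for \<omega>
    using N by (simp add: xX)
  interpret ML1: pair_sigma_finite M lborel ..
  define F :: "real \<times> (nat \<Rightarrow> real) \<Rightarrow> ennreal" where
    "F = (\<lambda>z. indicator {z. \<forall>k\<in>{..N}. (fst z - x N (snd z)) / 2 + x k (snd z) \<le> a + b * (real k / real N)} z)"
  have F[measurable]: "F \<in> borel_measurable (borel \<Otimes>\<^sub>M ?P)"
    unfolding F_def by measurable
  \<comment> \<open>\<open>H\<close> and \<open>H'\<close> describe the same integrand.
    \<open>H'\<close> takes the steps of \<open>X\<close> as its argument, \<open>H\<close> those of
    the gap itself, so \<open>H' u\<close> at the steps of \<open>X\<close> equals
    \<open>H u\<close> at b/N minus those steps.\<close>
  define H :: "real \<Rightarrow> (nat \<Rightarrow> real) \<Rightarrow> ennreal" where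
    "H u d = ennreal (2 * ?p (2 * a + b - 2 * u - x N d)) * indicator {d. \<forall>k\<in>{..N}. 0 \<le> u + x k d} d" for u d
  have H[measurable]: "H u \<in> borel_measurable ?P" for u
    unfolding H_def[abs_def] by measurable
  define H' :: "real \<Rightarrow> (nat \<Rightarrow> real) \<Rightarrow> ennreal" where
    "H' u d = ennreal (2 * ?p (2 * a + x N d - 2 * u)) * indicator {d. \<forall>k\<in>{..N}. 0 \<le> u + (b * (real k / real N) - x k d)} d" for u d
  have H'[measurable]: "(\<lambda>z. H' (fst z) (snd z)) \<in> borel_measurable (lborel \<Otimes>\<^sub>M ?P)"
    unfolding H'_def[abs_def] indicator_def by measurable
  let ?E = "{\<omega> \<in> space M. \<forall>k\<in>{..N}. B (real k / real N + 1) \<omega> - B (real k / real N) \<omega> \<le> a + b * (real k / real N)}"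
  have "emeasure M ?E =
    (\<integral>\<^sup>+\<omega>. F (B 2 \<omega> - B 0 \<omega>, ?\<Delta> \<omega>) \<partial>M)"
  proof -
    have F': "F (B 2 \<omega> - B 0 \<omega>, ?\<Delta> \<omega>) = indicator ?E \<omega>" if "\<omega> \<in> space M" for \<omega>
    proof -
      have "(\<forall>k\<in>{..N}. (B 2 \<omega> - B 0 \<omega> - x N (?\<Delta> \<omega>)) / 2 + x k (?\<Delta> \<omega>) \<le> a + b * (real k / real N)) \<longleftrightarrow>
        (\<forall>k\<in>{..N}. B (real k / real N + 1) \<omega> - B (real k / real N) \<omega> \<le> a + b * (real k / real N))"
        unfolding xN by (intro ball_cong refl) (simp only: slepian_eq xX atMost_iff)
      then show ?thesis
        unfolding F_def indicator_def using that by simp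
    qed
    have "?E \<in> sets M" by measurable
    then have "emeasure M ?E = (\<integral>\<^sup>+\<omega>. indicator ?E \<omega> \<partial>M)" by simp
    also have "\<dots> = (\<integral>\<^sup>+\<omega>. F (B 2 \<omega> - B 0 \<omega>, ?\<Delta> \<omega>) \<partial>M)"
      by (intro nn_integral_cong F'[symmetric])
    finally show ?thesis .
  qed
  also have "\<dots> = (\<integral>\<^sup>+\<omega>. \<integral>\<^sup>+y. ennreal (?p y) * F (y, ?\<Delta> \<omega>) \<partial>lborel \<partial>M)"
    by (rule nn_integral_total_steps[OF N F])
  also have "\<dots> = (\<integral>\<^sup>+\<omega>. \<integral>\<^sup>+u. H' u (?\<Delta> \<omega>) \<partial>lborel \<partial>M)"
  proof (rule nn_integral_cong)
    fix \<omega>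
    \<comment> \<open>For this fixed path, solving u = a - (y - X 1)/2 gives y = 2a + X 1 - 2u. The
      Jacobian 2 becomes the leading factor of \<open>H'\<close> and of
      \<open>weight\<close>.\<close>
    define d where "d = ?\<Delta> \<omega>"
    have d[measurable]: "d \<in> space ?P"
      by (auto simp: space_PiM d_def)
    have "(\<integral>\<^sup>+y. ennreal (?p y) * F (y, d) \<partial>lborel) =
      ennreal \<bar>-2\<bar> * (\<integral>\<^sup>+u. ennreal (?p ((2 * a + x N d) + (-2) * u)) * F ((2 * a + x N d) + (-2) * u, d) \<partial>lborel)"
      by (rule nn_integral_real_affine) auto
    also have "\<dots> = (\<integral>\<^sup>+u. ennreal 2 * (ennreal (?p ((2 * a + x N d) + (-2) * u)) * F ((2 * a + x N d) + (-2) * u, d)) \<partial>lborel)"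
      by (subst nn_integral_cmult) auto
    also have "\<dots> = (\<integral>\<^sup>+u. H' u d \<partial>lborel)"
    proof (rule nn_integral_cong)
      fix u
      have "F ((2 * a + x N d) + (-2) * u, d) = indicator {d. \<forall>k\<in>{..N}. 0 \<le> u + (b * (real k / real N) - x k d)} d"
      proof -
        have "(2 * a + x N d + (-2) * u - x N d) / 2 + x k d \<le> a + b * (real k / real N) \<longleftrightarrow>
          0 \<le> u + (b * (real k / real N) - x k d)" for k
          by argo
        then show ?thesis
          unfolding F_def indicator_def by simp
      qed
      then show "ennreal 2 * (ennreal (?p ((2 * a + x N d) + (-2) * u)) * F ((2 * a + x N d) + (-2) * u, d)) = H' u d"
        by (simp add: H'_def ennreal_mult mult.assoc)
    qed
    finally show "(\<integral>\<^sup>+y. ennreal (?p y) * F (y, ?\<Delta> \<omega>) \<partial>lborel) = (\<integral>\<^sup>+u. H' u (?\<Delta> \<omega>) \<partial>lborel)"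
      by (simp add: d_def)
  qed
  also have "\<dots> = (\<integral>\<^sup>+u. \<integral>\<^sup>+\<omega>. H' u (?\<Delta> \<omega>) \<partial>M \<partial>lborel)"
    by (rule ML1.Fubini'[symmetric]) (use measurable_compose[OF _ H', of "\<lambda>z. (snd z, ?\<Delta> (fst z))" "M \<Otimes>\<^sub>M lborel"] in \<open>simp add: split_beta'\<close>)
  also have "\<dots> = (\<integral>\<^sup>+u. \<integral>\<^sup>+\<omega>. ennreal (weight a b u (u + X 1 \<omega>)) * indicator {\<omega>. \<forall>k\<in>{..N}. 0 \<le> u + X (real k / real N) \<omega>} \<omega> \<partial>M \<partial>lborel)"
  proof (rule nn_integral_cong)
    fix u :: real
    have "H' u (?\<Delta> \<omega>) = H u (\<lambda>i\<in>{..<N}. b / real N - step N i \<omega>)" for \<omega>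
    proof -
      have "x k (\<lambda>i\<in>{..<N}. b / real N - step N i \<omega>) = b * (real k / real N) - x k (?\<Delta> \<omega>)" if "k \<le> N" for k
        using that by (simp add: x_def sum_subtractf)
      then show ?thesis
        using N unfolding H_def H'_def by (simp add: indicator_def add_diff_eq)
    qed
    then have "(\<integral>\<^sup>+\<omega>. H' u (?\<Delta> \<omega>) \<partial>M) = (\<integral>\<^sup>+\<omega>. H u (\<lambda>i\<in>{..<N}. b / real N - step N i \<omega>) \<partial>M)"
      by simp
    also have "\<dots> = (\<integral>\<^sup>+\<omega>. ennreal (exp (\<Sum>i<N. b / real N * step N i \<omega> / (sqrt (2 / real N))\<^sup>2 - (b / real N)\<^sup>2 / (2 * (sqrt (2 / real N))\<^sup>2))) * H u (?\<Delta> \<omega>) \<partial>M)"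
      using N step_normal[OF N] by (intro gaussian_shift_nn_integral step_indep) auto
    also have "\<dots> = (\<integral>\<^sup>+\<omega>. ennreal (weight a b u (u + X 1 \<omega>)) * indicator {\<omega>. \<forall>k\<in>{..N}. 0 \<le> u + X (real k / real N) \<omega>} \<omega> \<partial>M)"
    proof (rule nn_integral_cong)
      fix \<omega>
      \<comment> \<open>With step variance 2/N the tilt of one step is b/2 times the step minus
        b^2/(4N). The sum telescopes, so the tilt depends on the path only through X 1.\<close>
      have "(\<Sum>i<N. b / real N * step N i \<omega> / (sqrt (2 / real N))\<^sup>2 - (b / real N)\<^sup>2 / (2 * (sqrt (2 / real N))\<^sup>2)) =
        (\<Sum>i<N. b / 2 * step N i \<omega> - b\<^sup>2 / (4 * real N))"
        using N by (intro sum.cong) (auto simp: field_simps power2_eq_square)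
      also have "\<dots> = b * X 1 \<omega> / 2 - b\<^sup>2 / 4"
        unfolding sum_subtractf sum_distrib_left[symmetric] sum_step using N by simp
      finally have e: "(\<Sum>i<N. b / real N * step N i \<omega> / (sqrt (2 / real N))\<^sup>2 - (b / real N)\<^sup>2 / (2 * (sqrt (2 / real N))\<^sup>2)) =
        b * X 1 \<omega> / 2 - b\<^sup>2 / 4" .
      have w: "weight a b u (u + X 1 \<omega>) = exp (b * X 1 \<omega> / 2 - b\<^sup>2 / 4) * (2 * ?p (2 * a + b - 2 * u - X 1 \<omega>))"
        by (simp add: weight_def algebra_simps)
      have "indicator {d. \<forall>k\<in>{..N}. 0 \<le> u + x k d} (?\<Delta> \<omega>) = (indicator {\<omega>. \<forall>k\<in>{..N}. 0 \<le> u + X (real k / real N) \<omega>} \<omega> :: ennreal)"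
        by (simp add: indicator_def xX)
      then show "ennreal (exp (\<Sum>i<N. b / real N * step N i \<omega> / (sqrt (2 / real N))\<^sup>2 - (b / real N)\<^sup>2 / (2 * (sqrt (2 / real N))\<^sup>2))) * H u (?\<Delta> \<omega>) =
        ennreal (weight a b u (u + X 1 \<omega>)) * indicator {\<omega>. \<forall>k\<in>{..N}. 0 \<le> u + X (real k / real N) \<omega>} \<omega>"
        unfolding e H_def xN w
        by (subst ennreal_mult) (auto simp: mult_ac)
    qed
    finally show "(\<integral>\<^sup>+\<omega>. H' u (?\<Delta> \<omega>) \<partial>M) = \<dots>" .
  qed
  finally show ?thesis .
qed

end

section \<open>Reflection of symmetric random walks\<close>

text \<open>On the event exactly one summand survives, that of the first time. Off the event every
  summand vanishes, and the indicator on the right suppresses whatever value \<open>LEAST\<close>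
  takes.\<close>

lemma sum_first_time:
  fixes h :: "nat \<Rightarrow> ennreal"
  shows "(\<Sum>k\<le>N. h k * indicator {k. P k \<and> (\<forall>j\<in>{..<k}. \<not> P j)} k) =
    h (LEAST k. P k) * indicator {x. \<exists>k\<in>{..N}. P k} x"
proof (cases "\<exists>k\<in>{..N}. P k")
  case True
  let ?L = "LEAST k. P k"
  from True obtain k where k: "k \<le> N" "P k" by auto
  have L: "P ?L" "?L \<le> N" using k LeastI[of P k] Least_le[of P k] by auto
  have "P k \<and> (\<forall>j\<in>{..<k}. \<not> P j) \<longleftrightarrow> k = ?L" for k
    using L(1) not_less_Least[of _ P] Least_le[of P] by (metis lessThan_iff linorder_neqE_nat not_less)
  then have "(\<Sum>k\<le>N. h k * indicator {k. P k \<and> (\<forall>j\<in>{..<k}. \<not> P j)} k) = (\<Sum>k\<le>N. if k = ?L then h k else 0)"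
    by (intro sum.cong) (auto simp: indicator_def)
  also have "\<dots> = h ?L" using L(2) by simp
  finally show ?thesis using True by simp
next
  case False
  then show ?thesis by (auto simp: indicator_def intro!: sum.neutral)
qed

text \<open>Flipping the sign of every step after the first passage below zero preserves the law
  of a walk with independent symmetric steps.\<close>

lemma (in prob_space) symmetric_walk_reflection:
  fixes D :: "nat \<Rightarrow> 'a \<Rightarrow> real" and u :: real and g :: "real \<Rightarrow> ennreal"
  defines "S \<equiv> \<lambda>k \<omega>. u + (\<Sum>i<k. D i \<omega>)"
  assumes N: "0 < N" and ind: "indep_vars (\<lambda>_. borel) D {..<N}"
    and sym: "\<And>i. i < N \<Longrightarrow> distr M borel (D i) = distr M borel (\<lambda>\<omega>. - D i \<omega>)"
    and [measurable]: "g \<in> borel_measurable borel"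
  shows "(\<integral>\<^sup>+\<omega>. g (S N \<omega>) * indicator {\<omega>. \<exists>k\<in>{..N}. S k \<omega> < 0} \<omega> \<partial>M) =
    (\<integral>\<^sup>+\<omega>. g (2 * S (LEAST k. S k \<omega> < 0) \<omega> - S N \<omega>) * indicator {\<omega>. \<exists>k\<in>{..N}. S k \<omega> < 0} \<omega> \<partial>M)"
proof -
  let ?P = "PiM {..<N} (\<lambda>_. borel) :: (nat \<Rightarrow> real) measure"
  have mD: "\<And>i. i < N \<Longrightarrow> D i \<in> borel_measurable M" using ind by (auto simp: indep_vars_def)
  have S[measurable]: "S k \<in> borel_measurable M" if "k \<le> N" for k
    unfolding S_def using that mD by (intro borel_measurable_add borel_measurable_sum) auto
  have S2[measurable]: "S k \<in> borel_measurable M" if "k \<in> {..N}" for k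
    using that by simp
  let ?E = "\<lambda>k. {\<omega>. S k \<omega> < 0 \<and> (\<forall>j\<in>{..<k}. \<not> S j \<omega> < 0)}"
  have flip: "(\<integral>\<^sup>+\<omega>. g (S N \<omega>) * indicator (?E k) \<omega> \<partial>M) = (\<integral>\<^sup>+\<omega>. g (2 * S k \<omega> - S N \<omega>) * indicator (?E k) \<omega> \<partial>M)"
    if k: "k \<le> N" for k
  proof -
    \<comment> \<open>Only the steps from k on are flipped. The event \<open>?E k\<close> and the
      values of S up to time k are functions of the earlier steps and stay unchanged.\<close>
    define D' where "D' i \<omega> = (if i < k then D i \<omega> else - D i \<omega>)" for i \<omega>
    define x :: "nat \<Rightarrow> (nat \<Rightarrow> real) \<Rightarrow> real" where "x k d = (\<Sum>i<k. d i)" for k d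
    have x[measurable]: "k \<le> N \<Longrightarrow> x k \<in> borel_measurable ?P" for k
      unfolding x_def[abs_def] by (rule measurable_partial_sum)
    have x2[measurable]: "j \<in> {..<k} \<Longrightarrow> x j \<in> borel_measurable ?P" for j
      using k by simp
    define H :: "(nat \<Rightarrow> real) \<Rightarrow> ennreal" where
      "H d = g (u + x N d) * indicator {d. u + x k d < 0 \<and> (\<forall>j\<in>{..<k}. \<not> u + x j d < 0)} d" for d
    have H: "H \<in> borel_measurable ?P"
      unfolding H_def[abs_def] using k by measurable
    have ind': "indep_vars (\<lambda>_. borel) D' {..<N}"
      unfolding D'_def[abs_def]
      by (rule indep_vars_compose2[OF ind, where Y="\<lambda>i x. if i < k then x else - x"]) auto
    have "D' i = (if i < k then D i else (\<lambda>\<omega>. - D i \<omega>))" for i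
      by (auto simp: D'_def)
    then have "(\<integral>\<^sup>+\<omega>. H (\<lambda>i\<in>{..<N}. D i \<omega>) \<partial>M) = (\<integral>\<^sup>+\<omega>. H (\<lambda>i\<in>{..<N}. D' i \<omega>) \<partial>M)"
      using N sym by (intro indep_vars_same_law_nn_integral[OF _ ind ind' _ H]) auto
    moreover have xD: "u + x j (\<lambda>i\<in>{..<N}. D i \<omega>) = S j \<omega>" if "j \<le> N" for j \<omega>
      using that by (auto simp: x_def S_def intro!: sum.cong)
    moreover have xD': "u + x j (\<lambda>i\<in>{..<N}. D' i \<omega>) = S j \<omega>" if "j \<le> k" for j \<omega>
      using that k by (auto simp: x_def S_def D'_def intro!: sum.cong)
    moreover have "u + x N (\<lambda>i\<in>{..<N}. D' i \<omega>) = 2 * S k \<omega> - S N \<omega>" for \<omega>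
    proof -
      \<comment> \<open>Splitting at k shows that the flipped walk ends at S k - (S N - S
        k).\<close>
      have un: "{..<N} = {..<k} \<union> {k..<N}" using k by auto
      have "(\<Sum>i<N. D' i \<omega>) = (\<Sum>i<k. D' i \<omega>) + (\<Sum>i=k..<N. D' i \<omega>)"
        unfolding un by (rule sum.union_disjoint) auto
      also have "\<dots> = (\<Sum>i<k. D i \<omega>) - (\<Sum>i=k..<N. D i \<omega>)"
        by (simp add: D'_def sum_negf)
      finally have 1: "(\<Sum>i<N. D' i \<omega>) = (\<Sum>i<k. D i \<omega>) - (\<Sum>i=k..<N. D i \<omega>)" .
      have 2: "(\<Sum>i<N. D i \<omega>) = (\<Sum>i<k. D i \<omega>) + (\<Sum>i=k..<N. D i \<omega>)"
        unfolding un by (rule sum.union_disjoint) auto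
      have "x N (\<lambda>i\<in>{..<N}. D' i \<omega>) = (\<Sum>i<N. D' i \<omega>)" by (simp add: x_def)
      then show ?thesis unfolding S_def using 1 2 by simp
    qed
    ultimately show ?thesis
      using k by (simp add: H_def indicator_def)
  qed
  \<comment> \<open>On \<open>?E k\<close> the first passage time is k, so the random index can be
    replaced by a finite sum over deterministic ones, to each of which \<open>flip\<close>
    applies.\<close>
  have split: "f (LEAST k. S k \<omega> < 0) * indicator {\<omega>. \<exists>k\<in>{..N}. S k \<omega> < 0} \<omega> = (\<Sum>k\<le>N. f k * indicator (?E k) \<omega>)"
    for f :: "nat \<Rightarrow> ennreal" and \<omega>
    using sum_first_time[where N=N and h=f and P="\<lambda>k. S k \<omega> < 0" and x=\<omega>] by (simp add: indicator_def)
  have mE[measurable]: "?E k \<inter> space M \<in> sets M" if "k \<le> N" for k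
  proof -
    have [measurable]: "j \<in> {..<k} \<Longrightarrow> S j \<in> borel_measurable M" for j
      using that by simp
    have "{\<omega> \<in> space M. S k \<omega> < 0 \<and> (\<forall>j\<in>{..<k}. \<not> S j \<omega> < 0)} \<in> sets M"
      using that by measurable
    then show ?thesis by (simp add: Int_def conj_commute)
  qed
  have iE: "(\<lambda>\<omega>. indicator (?E k) \<omega> :: ennreal) \<in> borel_measurable M" if "k \<le> N" for k
    using mE[OF that] by (simp add: borel_measurable_indicator_iff)
  have m1: "(\<lambda>\<omega>. g (S N \<omega>) * indicator (?E k) \<omega>) \<in> borel_measurable M"
    and m2: "(\<lambda>\<omega>. g (2 * S k \<omega> - S N \<omega>) * indicator (?E k) \<omega>) \<in> borel_measurable M" if "k \<le> N" for k
    using iE[OF that] S[OF that] S[of N] by measurable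
  have "(\<integral>\<^sup>+\<omega>. g (S N \<omega>) * indicator {\<omega>. \<exists>k\<in>{..N}. S k \<omega> < 0} \<omega> \<partial>M) = (\<Sum>k\<le>N. \<integral>\<^sup>+\<omega>. g (S N \<omega>) * indicator (?E k) \<omega> \<partial>M)"
    using m1 by (subst nn_integral_sum[symmetric]) (auto simp: split[of "\<lambda>_. g (S N _)"])
  also have "\<dots> = (\<Sum>k\<le>N. \<integral>\<^sup>+\<omega>. g (2 * S k \<omega> - S N \<omega>) * indicator (?E k) \<omega> \<partial>M)"
    using flip by (intro sum.cong) auto
  also have "\<dots> = (\<integral>\<^sup>+\<omega>. g (2 * S (LEAST k. S k \<omega> < 0) \<omega> - S N \<omega>) * indicator {\<omega>. \<exists>k\<in>{..N}. S k \<omega> < 0} \<omega> \<partial>M)"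
    using m2 by (subst nn_integral_sum[symmetric]) (auto simp: split[of "\<lambda>k. g (2 * S k _ - S N _)"])
  finally show ?thesis .
qed

section \<open>Vanishing overshoot and the limit of the survival integrals\<close>

context brownian_motion
begin

lemma X1_normal: "distributed M lborel (X 1) (normal_density 0 (sqrt 2))"
proof -
  have "step 1 0 = X 1" by (auto simp: step_def)
  then show ?thesis using step_normal[of 1 0] by simp
qed

text \<open>Used with c = -u to exclude paths ending exactly at zero, where the cut-off at 0 is
  discontinuous.\<close>

lemma AE_X1_neq: "AE \<omega> in M. X 1 \<omega> \<noteq> c"
proof -
  have "(\<integral>\<^sup>+\<omega>. indicator {c} (X 1 \<omega>) \<partial>M) = (\<integral>\<^sup>+x. ennreal (normal_density 0 (sqrt 2) x) * indicator {c} x \<partial>lborel)"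
    by (subst distributed_nn_integral[OF X1_normal]) auto
  also have "\<dots> = (\<integral>\<^sup>+x. 0 \<partial>(lborel :: real measure))"
    by (rule nn_integral_cong_AE) (use AE_lborel_singleton[of c] in \<open>auto elim!: eventually_mono\<close>)
  finally have "(\<integral>\<^sup>+\<omega>. indicator {c} (X 1 \<omega>) \<partial>M) = 0" by simp
  then have "AE \<omega> in M. indicator {c} (X 1 \<omega>) = (0::ennreal)"
    by (subst (asm) nn_integral_0_iff_AE) auto
  then show ?thesis by eventually_elim (auto simp: indicator_def split: if_splits)
qed

text \<open>The walk is still nonnegative one grid point before its first passage, so the overshoot
  is at most the oscillation of the path over a time 2^-m, which uniform continuity makes small. A
  negative endpoint keeps the first passage index within the grid, hence its time within
  [0,1].\<close>

lemma overshoot_tendsto_0: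
  assumes \<omega>: "\<omega> \<in> space M" and u: "0 \<le> u" and neg: "u + X 1 \<omega> < 0"
  shows "(\<lambda>m. u + X (real (LEAST k. u + X (real k / 2 ^ m) \<omega> < 0) / 2 ^ m) \<omega>) \<longlonglongrightarrow> 0"
proof (rule LIMSEQ_I)
  fix e :: real assume e: "0 < e"
  have "uniformly_continuous_on {0..1} (\<lambda>t. X t \<omega>)"
    by (rule compact_uniformly_continuous[OF continuous_X[OF \<omega>]]) simp
  then obtain d where d: "0 < d"
    and dX: "\<And>s t. s \<in> {0..1} \<Longrightarrow> t \<in> {0..1} \<Longrightarrow> dist t s < d \<Longrightarrow> dist (X t \<omega>) (X s \<omega>) < e"
    unfolding uniformly_continuous_on_def using e by metis
  obtain m0 where m0: "(1/2::real) ^ m0 < d"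
    using real_arch_pow_inv[OF d, of "1/2"] by auto
  show "\<exists>m0. \<forall>m\<ge>m0. norm (u + X (real (LEAST k. u + X (real k / 2 ^ m) \<omega> < 0) / 2 ^ m) \<omega> - 0) < e"
  proof (intro exI allI impI)
    fix m assume m: "m0 \<le> m"
    let ?P = "\<lambda>k. u + X (real k / 2 ^ m) \<omega> < 0"
    define L where "L = (LEAST k. ?P k)"
    have PN: "?P (2 ^ m)" using neg by simp
    have L: "?P L" unfolding L_def by (rule LeastI[of ?P, OF PN])
    have LN: "L \<le> 2 ^ m" unfolding L_def by (rule Least_le[of ?P, OF PN])
    \<comment> \<open>The start \<open>u\<close> is nonnegative, so the first passage has a
      predecessor on the grid.\<close>
    have "L \<noteq> 0" using L u by (metis X_0 add.right_neutral div_0 not_less of_nat_0)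
    then obtain l where l: "L = Suc l" by (cases L) auto
    have nl: "\<not> ?P l" using not_less_Least[of l ?P] l unfolding L_def by simp
    have dd: "real L / 2 ^ m - real l / 2 ^ m = (1/2) ^ m"
      unfolding l by (simp add: field_simps power_one_over)
    have "(1/2::real) ^ m \<le> (1/2) ^ m0" using m by (intro power_decreasing) auto
    then have "dist (real L / 2 ^ m) (real l / 2 ^ m) < d"
      unfolding dist_real_def dd using m0 by (metis abs_power2 abs_of_nonneg order_le_less_trans zero_le_power half_gt_zero_iff less_imp_le zero_less_one)
    moreover have L1: "real L \<le> 2 ^ m"
      using LN by (metis of_nat_le_iff of_nat_numeral of_nat_power)
    moreover have "real l \<le> 2 ^ m"
      using L1 unfolding l by linarith
    ultimately have "dist (X (real L / 2 ^ m) \<omega>) (X (real l / 2 ^ m) \<omega>) < e"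
      by (intro dX) (simp_all only: atLeastAtMost_iff divide_le_eq_1_pos zero_less_power zero_less_numeral, simp_all)
    then have "\<bar>u + X (real L / 2 ^ m) \<omega>\<bar> < e"
      using L nl by (auto simp: dist_real_def)
    then show "norm (u + X (real (LEAST k. ?P k) / 2 ^ m) \<omega> - 0) < e"
      unfolding L_def by simp
  qed
qed

text \<open>The mass ending above zero splits into surviving and crossed paths. Reflection turns the
  crossed part into an integral of \<open>gp\<close> at the reflected endpoint, which tends to -(u +
  X 1) on paths ending below zero; the bound \<open>C\<close> permits dominated convergence.\<close>

lemma survival_limit:
  fixes g :: "real \<Rightarrow> real"
  assumes g: "continuous_on UNIV g" "\<And>v. 0 \<le> g v" "\<And>v. g v \<le> C" and u: "0 \<le> u"
  defines "gp \<equiv> \<lambda>v. ennreal (g v) * indicator {0..} v"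
  shows "(\<lambda>m. \<integral>\<^sup>+\<omega>. ennreal (g (u + X 1 \<omega>)) * indicator {\<omega>. \<forall>k\<in>{..2 ^ m}. 0 \<le> u + X (real k / 2 ^ m) \<omega>} \<omega> \<partial>M)
    \<longlonglongrightarrow> (\<integral>\<^sup>+\<omega>. gp (u + X 1 \<omega>) \<partial>M) - (\<integral>\<^sup>+\<omega>. gp (- (u + X 1 \<omega>)) \<partial>M)"
proof -
  have [measurable]: "g \<in> borel_measurable borel"
    using g(1) by (rule borel_measurable_continuous_onI)
  have [measurable]: "gp \<in> borel_measurable borel"
    unfolding gp_def by measurable
  have gpC: "gp v \<le> ennreal C" for v
    using g(3)[of v] by (auto simp: gp_def indicator_def intro: ennreal_leI)
  define J where "J m = (\<integral>\<^sup>+\<omega>. ennreal (g (u + X 1 \<omega>)) * indicator {\<omega>. \<forall>k\<in>{..2 ^ m}. 0 \<le> u + X (real k / 2 ^ m) \<omega>} \<omega> \<partial>M)" for m :: nat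
  \<comment> \<open>The endpoint after reflection at the first grid value below zero: twice the
    overshoot minus the original endpoint.\<close>
  define R where "R m \<omega> = 2 * (u + X (real (LEAST k. u + X (real k / 2 ^ m) \<omega> < 0) / 2 ^ m) \<omega>) - (u + X 1 \<omega>)" for m :: nat and \<omega>
  define q where "q m \<omega> = gp (R m \<omega>) * indicator {\<omega>. \<exists>k\<in>{..2 ^ m}. u + X (real k / 2 ^ m) \<omega> < 0} \<omega>" for m :: nat and \<omega>
  define A where "A = (\<integral>\<^sup>+\<omega>. gp (u + X 1 \<omega>) \<partial>M)"
  have bound: "(\<integral>\<^sup>+\<omega>. h \<omega> \<partial>M) \<le> ennreal C" if "\<And>\<omega>. h \<omega> \<le> ennreal C" for h
    using nn_integral_mono[of M h "\<lambda>_. ennreal C"] that by (simp add: emeasure_space_1)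
  have A_fin: "A \<noteq> top"
    using bound[of "\<lambda>\<omega>. gp (u + X 1 \<omega>)"] gpC unfolding A_def by (auto simp: top_unique)
  have qC: "q m \<omega> \<le> ennreal C" for m \<omega>
    using gpC unfolding q_def by (auto simp: indicator_def)
  have L: "(\<lambda>\<omega>. LEAST k. u + X (real k / 2 ^ m) \<omega> < 0) \<in> M \<rightarrow>\<^sub>M count_space UNIV" for m :: nat
    by measurable
  have [measurable]: "(\<lambda>\<omega>. X (real (LEAST k. u + X (real k / 2 ^ m) \<omega> < 0) / 2 ^ m) \<omega>) \<in> borel_measurable M" for m :: nat
    by (rule measurable_compose_countable[OF _ L, where f="\<lambda>k \<omega>. X (real k / 2 ^ m) \<omega>"]) measurable
  have qm[measurable]: "q m \<in> borel_measurable M" for m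
    unfolding q_def[abs_def] R_def[abs_def] by measurable
  \<comment> \<open>Survival includes the grid point k = 2^m, that is time 1, so the surviving paths
    end at or above zero and there \<open>gp\<close> agrees with g.\<close>
  have split: "A = J m + (\<integral>\<^sup>+\<omega>. q m \<omega> \<partial>M)" for m
  proof -
    let ?N = "2 ^ m :: nat"
    have S: "u + (\<Sum>i<k. step ?N i \<omega>) = u + X (real k / 2 ^ m) \<omega>" for k \<omega>
      by (simp add: sum_step)
    have sym: "distr M borel (step ?N i) = distr M borel (\<lambda>\<omega>. - step ?N i \<omega>)" if "i < ?N" for i
    proof -
      have n: "distributed M lborel (step ?N i) (normal_density 0 (sqrt (2 / real ?N)))"
        using that by (intro step_normal) auto
      have "distributed M lborel (\<lambda>\<omega>. - step ?N i \<omega>) (normal_density 0 (sqrt (2 / real ?N)))"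
        using normal_density_affine[OF n, of "-1" 0] by simp
      with n show ?thesis by (simp add: distr_borel_eq_density)
    qed
    have q: "(\<integral>\<^sup>+\<omega>. q m \<omega> \<partial>M) = (\<integral>\<^sup>+\<omega>. gp (u + X 1 \<omega>) * indicator {\<omega>. \<exists>k\<in>{..2 ^ m}. u + X (real k / 2 ^ m) \<omega> < 0} \<omega> \<partial>M)"
      using symmetric_walk_reflection[where N="?N" and g=gp and u=u, OF _ step_indep sym] unfolding S q_def R_def by simp
    have "A = (\<integral>\<^sup>+\<omega>. ennreal (g (u + X 1 \<omega>)) * indicator {\<omega>. \<forall>k\<in>{..2 ^ m}. 0 \<le> u + X (real k / 2 ^ m) \<omega>} \<omega> +
       gp (u + X 1 \<omega>) * indicator {\<omega>. \<exists>k\<in>{..2 ^ m}. u + X (real k / 2 ^ m) \<omega> < 0} \<omega> \<partial>M)"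
      unfolding A_def
    proof (rule nn_integral_cong)
      fix \<omega>
      have "0 \<le> u + X 1 \<omega>" if "\<forall>k\<in>{..2 ^ m}. 0 \<le> u + X (real k / 2 ^ m) \<omega>"
        using that[rule_format, of "2 ^ m"] by simp
      then show "gp (u + X 1 \<omega>) = ennreal (g (u + X 1 \<omega>)) * indicator {\<omega>. \<forall>k\<in>{..2 ^ m}. 0 \<le> u + X (real k / 2 ^ m) \<omega>} \<omega> +
       gp (u + X 1 \<omega>) * indicator {\<omega>. \<exists>k\<in>{..2 ^ m}. u + X (real k / 2 ^ m) \<omega> < 0} \<omega>"
        by (cases "\<forall>k\<in>{..2 ^ m}. 0 \<le> u + X (real k / 2 ^ m) \<omega>") (auto simp: gp_def indicator_def not_less not_le)
    qed
    also have "\<dots> = J m + (\<integral>\<^sup>+\<omega>. q m \<omega> \<partial>M)"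
      unfolding q J_def by (rule nn_integral_add) measurable
    finally show ?thesis .
  qed
  have J: "J m = A - (\<integral>\<^sup>+\<omega>. q m \<omega> \<partial>M)" for m
  proof -
    have "(\<integral>\<^sup>+\<omega>. q m \<omega> \<partial>M) \<noteq> top" using bound[of "q m", OF qC] by (auto simp: top_unique)
    then show ?thesis unfolding split[of m] by simp
  qed
  have Q: "(\<lambda>m. \<integral>\<^sup>+\<omega>. q m \<omega> \<partial>M) \<longlonglongrightarrow> (\<integral>\<^sup>+\<omega>. gp (- (u + X 1 \<omega>)) \<partial>M)"
  proof (rule nn_integral_dominated_convergence[where w="\<lambda>_. ennreal C"])
    show "(\<integral>\<^sup>+\<omega>. ennreal C \<partial>M) < \<infinity>" by (simp add: emeasure_space_1)
    show "AE \<omega> in M. (\<lambda>m. q m \<omega>) \<longlonglongrightarrow> gp (- (u + X 1 \<omega>))"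
      using AE_X1_neq[of "-u"] AE_space
    proof eventually_elim
      fix \<omega> assume ne: "X 1 \<omega> \<noteq> - u" and \<omega>: "\<omega> \<in> space M"
      show "(\<lambda>m. q m \<omega>) \<longlonglongrightarrow> gp (- (u + X 1 \<omega>))"
      proof (cases "u + X 1 \<omega> < 0")
        case True
        have "\<exists>k\<in>{..2 ^ m}. u + X (real k / 2 ^ m) \<omega> < 0" for m :: nat
          using True by (intro bexI[of _ "2 ^ m"]) auto
        then have q: "q m \<omega> = gp (R m \<omega>)" for m by (simp add: q_def)
        \<comment> \<open>The limit is strictly positive, so R m is eventually positive and
          \<open>gp\<close> can be replaced by the continuous function g when passing to the
          limit.\<close>
        have R: "(\<lambda>m. R m \<omega>) \<longlonglongrightarrow> - (u + X 1 \<omega>)"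
          unfolding R_def by (rule tendsto_eq_intros overshoot_tendsto_0[OF \<omega> u True] refl)+ simp
        have "\<forall>\<^sub>F m in sequentially. 0 < R m \<omega>"
          using True by (intro order_tendstoD(1)[OF R]) simp
        then have ev: "\<forall>\<^sub>F m in sequentially. ennreal (g (R m \<omega>)) = gp (R m \<omega>)"
          by eventually_elim (simp add: gp_def)
        have "(\<lambda>m. ennreal (g (R m \<omega>))) \<longlonglongrightarrow> ennreal (g (- (u + X 1 \<omega>)))"
          by (intro tendsto_ennrealI continuous_on_tendsto_compose[OF g(1) R]) auto
        then have "(\<lambda>m. gp (R m \<omega>)) \<longlonglongrightarrow> ennreal (g (- (u + X 1 \<omega>)))"
          by (rule Lim_transform_eventually[OF _ ev])
        then show ?thesis using True by (simp add: q gp_def)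
      next
        case False
        then have pos: "0 < u + X 1 \<omega>" using ne by linarith
        have "q m \<omega> = 0" for m
        proof (cases "\<exists>k. u + X (real k / 2 ^ m) \<omega> < 0")
          case True
          then have "u + X (real (LEAST k. u + X (real k / 2 ^ m) \<omega> < 0) / 2 ^ m) \<omega> < 0"
            by (rule LeastI_ex)
          moreover have "2 * x - y < 0" if "x < 0" "0 < y" for x y :: real
            using that by linarith
          ultimately have "R m \<omega> < 0" unfolding R_def using pos by blast
          then show ?thesis by (simp add: q_def gp_def)
        qed (auto simp: q_def indicator_def)
        then show ?thesis using pos by (simp add: gp_def)
      qed
    qed
  qed (use qC in auto)
  have "(\<integral>\<^sup>+\<omega>. gp (- (u + X 1 \<omega>)) \<partial>M) \<noteq> top"
    using bound[of "\<lambda>\<omega>. gp (- (u + X 1 \<omega>))"] gpC by (auto simp: top_unique)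
  then have "(\<lambda>m. A - (\<integral>\<^sup>+\<omega>. q m \<omega> \<partial>M)) \<longlonglongrightarrow> A - (\<integral>\<^sup>+\<omega>. gp (- (u + X 1 \<omega>)) \<partial>M)"
    using A_fin by (intro tendsto_diff_ennreal Q tendsto_const) auto
  then show ?thesis
    unfolding J[symmetric] by (simp add: J_def A_def)
qed

end

section \<open>Integrals of the standard normal density\<close>

lemma phi_eq_normal_density: "phi = normal_density 0 1"
  by (auto simp: phi_def normal_density_def)

lemma measurable_phi[measurable]: "phi \<in> borel_measurable borel"
  unfolding phi_eq_normal_density by measurable

lemma phi_nonneg[simp]: "0 \<le> phi x"
  by (simp add: phi_eq_normal_density)

lemma has_bochner_integral_phi_shift:
  "has_bochner_integral lborel (\<lambda>s. phi (c - s) * indicator {0..} s) (Phi c)"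
proof -
  have i: "integrable lborel (\<lambda>s. indicator {..c} s *\<^sub>R phi s)"
    unfolding phi_eq_normal_density by (intro integrable_mult_indicator) auto
  then have "has_bochner_integral lborel (\<lambda>s. indicator {..c} s *\<^sub>R phi s) (Phi c)"
    unfolding Phi_def set_lebesgue_integral_def by (rule has_bochner_integral_integrable)
  from lborel_has_bochner_integral_real_affine_iff[THEN iffD1, OF _ this, of "-1" c]
  have "has_bochner_integral lborel (\<lambda>s. indicator {..c} (c + -1 * s) *\<^sub>R phi (c + -1 * s)) (Phi c)"
    by simp
  also have "(\<lambda>s. indicator {..c} (c + -1 * s) *\<^sub>R phi (c + -1 * s)) = (\<lambda>s. phi (c - s) * indicator {0..} s)"
    by (auto simp: indicator_def)
  finally show ?thesis .
qed

lemma nn_integral_phi_shift: "(\<integral>\<^sup>+s. ennreal (phi (c - s)) * indicator {0..} s \<partial>lborel) = ennreal (Phi c)"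
proof -
  have "(\<integral>\<^sup>+s. ennreal (phi (c - s)) * indicator {0..} s \<partial>lborel) = (\<integral>\<^sup>+s. ennreal (phi (c - s) * indicator {0..} s) \<partial>lborel)"
    by (intro nn_integral_cong) (auto simp: indicator_def)
  also have "\<dots> = ennreal (Phi c)"
    using has_bochner_integral_phi_shift[of c]
    by (subst nn_integral_eq_integral) (auto simp: has_bochner_integral_iff)
  finally show ?thesis .
qed

lemma Phi_nonneg: "0 \<le> Phi x"
  unfolding Phi_def set_lebesgue_integral_def by (intro integral_nonneg_AE) auto

text \<open>The origin of the factor sqrt(2 pi) phi(b) exp(-ab) in the final formula.\<close>

lemma phi_add: "phi (a + b) = phi a * (sqrt (2 * pi) * phi b * exp (- (a * b)))"
proof -
  have "- ((a + b)\<^sup>2) / 2 = - (a\<^sup>2) / 2 + - (b\<^sup>2) / 2 + - (a * b)"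
    by (simp add: field_simps power2_eq_square)
  then have e: "exp (- ((a + b)\<^sup>2) / 2) = exp (- (a\<^sup>2) / 2) * exp (- (b\<^sup>2) / 2) * exp (- (a * b))"
    by (simp only: exp_add)
  show ?thesis
    unfolding phi_def e by simp
qed

lemma phi_diff: "phi (c - s) = phi c * exp (- (s\<^sup>2) / 2 + c * s)"
proof -
  have "- ((c - s)\<^sup>2) / 2 = - (c\<^sup>2) / 2 + (- (s\<^sup>2) / 2 + c * s)"
    by (simp add: field_simps power2_eq_square)
  then have e: "exp (- ((c - s)\<^sup>2) / 2) = exp (- (c\<^sup>2) / 2) * exp (- (s\<^sup>2) / 2 + c * s)"
    by (simp only: exp_add)
  show ?thesis
    unfolding phi_def e by simp
qed

text \<open>With s = u + v the quadratic terms u^2/2, v^2/2 and uv combine to s^2/2, so the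
  integrand becomes phi(a) phi(a+b-s) exp(-bu) on 0 \<le> u \<le> s. The u-integral is elementary
  and produces the division by b.\<close>

lemma quadrant_integral:
  fixes a b :: real
  assumes b: "b \<noteq> 0"
  defines "K \<equiv> (phi a * Phi (a + b) - phi (a + b) * Phi a) / b"
  shows "(\<integral>\<^sup>+u. (\<integral>\<^sup>+v. ennreal (phi (a - u) * phi (a + b - v) * exp (- (u * v))) * indicator {0..} v \<partial>lborel) * indicator {0..} u \<partial>lborel) = ennreal K"
    and "0 \<le> K"
proof -
  let ?f = "\<lambda>s. phi a * phi (a + b - s)"
  define h where "h s = (phi a * phi (a + b - s) - phi (a + b) * phi (a - s)) / b" for s
  have inner: "(\<integral>\<^sup>+u. ennreal (exp (- (b * u))) * indicator {0..s} u \<partial>lborel) = ennreal ((1 - exp (- (b * s))) / b)" if "0 \<le> s" for s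
  proof -
    have "(\<integral>\<^sup>+u. ennreal (exp (- (b * u))) * indicator {0..s} u \<partial>lborel) = ennreal ((- exp (- (b * s)) / b) - (- exp (- (b * 0)) / b))"
      by (rule nn_integral_FTC_Icc) (use b that in \<open>auto intro!: derivative_eq_intros\<close>)
    also have "(- exp (- (b * s)) / b) - (- exp (- (b * 0)) / b) = (1 - exp (- (b * s))) / b"
      by (simp add: field_simps diff_divide_distrib)
    finally show ?thesis .
  qed
  \<comment> \<open>Two forms of one function: this product is what the u-integration yields, while
    the defining difference integrates in s to \<open>K\<close>. They agree because phi(a)
    phi(a+b-s) exp(-bs) = phi(a+b) phi(a-s).\<close>
  have h: "h s = ?f s * ((1 - exp (- (b * s))) / b)" for s
    unfolding h_def phi_diff by (simp add: field_simps exp_add[symmetric] exp_diff[symmetric])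
  have h_nonneg: "0 \<le> h s" if "0 \<le> s" for s
  proof -
    \<comment> \<open>Numerator and denominator have the same sign for s \<ge> 0, whichever sign b
      has.\<close>
    have "0 \<le> (1 - exp (- (b * s))) / b"
      using b that by (cases "0 < b") (auto simp: divide_nonneg_pos mult_nonpos_nonneg divide_nonpos_neg)
    then show ?thesis unfolding h by (intro mult_nonneg_nonneg) auto
  qed
  have change: "(\<integral>\<^sup>+v. ennreal (phi (a - u) * phi (a + b - v) * exp (- (u * v))) * indicator {0..} v \<partial>lborel) * indicator {0..} u =
    (\<integral>\<^sup>+s. ennreal (?f s) * (ennreal (exp (- (b * u))) * indicator {0..s} u) \<partial>lborel)" for u
  proof -
    have e: "phi (a - u) * phi (a + b - (-u + 1 * s)) * exp (- (u * (-u + 1 * s))) = ?f s * exp (- (b * u))" for s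
      unfolding phi_diff
      by (simp add: mult.assoc exp_add[symmetric] power2_eq_square field_simps)
    have v: "(\<integral>\<^sup>+v. ennreal (phi (a - u) * phi (a + b - v) * exp (- (u * v))) * indicator {0..} v \<partial>lborel) =
      (\<integral>\<^sup>+s. ennreal (?f s * exp (- (b * u))) * indicator {0..} (- u + 1 * s) \<partial>lborel)"
      by (subst nn_integral_real_affine[where c=1 and t="-u"], measurable) (simp only: e, simp)
    have "(\<integral>\<^sup>+s. ennreal (?f s * exp (- (b * u))) * indicator {0..} (- u + 1 * s) \<partial>lborel) * indicator {0..} u = (\<integral>\<^sup>+s. ennreal (?f s * exp (- (b * u))) * indicator {0..} (- u + 1 * s) * indicator {0..} u \<partial>lborel)"
      by (rule nn_integral_multc[symmetric]) measurable
    also have "\<dots> = (\<integral>\<^sup>+s. ennreal (?f s) * (ennreal (exp (- (b * u))) * indicator {0..s} u) \<partial>lborel)"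
    proof (rule nn_integral_cong)
      fix s :: real
      \<comment> \<open>The quadrant u, v \<ge> 0 becomes the wedge 0 \<le> u \<le> s.\<close>
      have "indicator {0..} (- u + 1 * s) * indicator {0..} u = (indicator {0..s} u :: ennreal)"
        by (cases "0 \<le> u"; cases "u \<le> s") simp_all
      then show "ennreal (?f s * exp (- (b * u))) * indicator {0..} (- u + 1 * s) * indicator {0..} u =
        ennreal (?f s) * (ennreal (exp (- (b * u))) * indicator {0..s} u)"
        by (subst ennreal_mult) (simp_all only: mult.assoc mult_nonneg_nonneg phi_nonneg exp_ge_zero)
    qed
    finally show ?thesis unfolding v .
  qed
  have "(\<integral>\<^sup>+u. (\<integral>\<^sup>+v. ennreal (phi (a - u) * phi (a + b - v) * exp (- (u * v))) * indicator {0..} v \<partial>lborel) * indicator {0..} u \<partial>lborel) =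
    (\<integral>\<^sup>+u. \<integral>\<^sup>+s. ennreal (?f s) * (ennreal (exp (- (b * u))) * indicator {0..s} u) \<partial>lborel \<partial>lborel)"
    by (simp only: change)
  also have "\<dots> = (\<integral>\<^sup>+s. \<integral>\<^sup>+u. ennreal (?f s) * (ennreal (exp (- (b * u))) * indicator {0..s} u) \<partial>lborel \<partial>lborel)"
    by (rule lborel_pair.Fubini') (simp add: indicator_def, measurable)
  also have "\<dots> = (\<integral>\<^sup>+s. ennreal (h s * indicator {0..} s) \<partial>lborel)"
  proof (rule nn_integral_cong)
    fix s :: real
    have "(\<integral>\<^sup>+u. ennreal (?f s) * (ennreal (exp (- (b * u))) * indicator {0..s} u) \<partial>lborel) =
      ennreal (?f s) * (\<integral>\<^sup>+u. ennreal (exp (- (b * u))) * indicator {0..s} u \<partial>lborel)"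
      by (rule nn_integral_cmult) measurable
    also have "\<dots> = ennreal (h s * indicator {0..} s)"
    proof (cases "0 \<le> s")
      case True
      then show ?thesis unfolding h inner[OF True] by (subst ennreal_mult'[symmetric]) auto
    qed simp
    finally show "(\<integral>\<^sup>+u. ennreal (?f s) * (ennreal (exp (- (b * u))) * indicator {0..s} u) \<partial>lborel) = \<dots>" .
  qed
  finally have eq: "(\<integral>\<^sup>+u. (\<integral>\<^sup>+v. ennreal (phi (a - u) * phi (a + b - v) * exp (- (u * v))) * indicator {0..} v \<partial>lborel) * indicator {0..} u \<partial>lborel) =
    (\<integral>\<^sup>+s. ennreal (h s * indicator {0..} s) \<partial>lborel)" .
  have "has_bochner_integral lborel (\<lambda>s. (phi a * (phi (a + b - s) * indicator {0..} s) - phi (a + b) * (phi (a - s) * indicator {0..} s)) / b) K"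
    unfolding K_def
    by (intro has_bochner_integral_divide_zero has_bochner_integral_diff has_bochner_integral_mult_right has_bochner_integral_phi_shift)
  then have hK: "has_bochner_integral lborel (\<lambda>s. h s * indicator {0..} s) K"
    by (rule has_bochner_integral_cong[THEN iffD1, rotated -1]) (auto simp: h_def field_simps)
  have nn: "0 \<le> h s * indicator {0..} s" for s
    using h_nonneg[of s] by (auto simp: indicator_def)
  show K: "0 \<le> K"
    using hK nn by (metis Bochner_Integration.integral_nonneg has_bochner_integral_integral_eq)
  show "(\<integral>\<^sup>+u. (\<integral>\<^sup>+v. ennreal (phi (a - u) * phi (a + b - v) * exp (- (u * v))) * indicator {0..} v \<partial>lborel) * indicator {0..} u \<partial>lborel) = ennreal K"
    unfolding eq using hK nn by (subst nn_integral_eq_integral) (auto simp: has_bochner_integral_iff)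
qed

section \<open>The weight against the Gaussian transition density\<close>

text \<open>Completing the square in v absorbs the linear tilt: for fixed u the weight is a Gaussian
  bump centred at 2a + 2b - u, hence bounded in v. This supplies the constant \<open>C\<close> for
  \<open>survival_limit\<close>.\<close>

lemma weight_eq:
  "weight a b u v = 2 * (exp (- ((v - (2 * a + 2 * b - u))\<^sup>2) / 4) / sqrt (4 * pi)) * exp (b * (2 * a + b - 2 * u) / 2)"
proof -
  have "- ((2 * a + b - u - v)\<^sup>2) / 4 + (b * (v - u) / 2 - b\<^sup>2 / 4) =
    - ((v - (2 * a + 2 * b - u))\<^sup>2) / 4 + b * (2 * a + b - 2 * u) / 2"
    by (simp add: field_simps power2_eq_square)
  then have "exp (- ((2 * a + b - u - v)\<^sup>2) / 4) * exp (b * (v - u) / 2 - b\<^sup>2 / 4) =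
    exp (- ((v - (2 * a + 2 * b - u))\<^sup>2) / 4) * exp (b * (2 * a + b - 2 * u) / 2)"
    by (simp only: exp_add[symmetric])
  then show ?thesis
    by (simp add: weight_def normal_density_def)
qed

lemma weight_bounds:
  "0 \<le> weight a b u v"
  "weight a b u v \<le> 2 / sqrt (4 * pi) * exp (b * (2 * a + b - 2 * u) / 2)"
proof -
  show "0 \<le> weight a b u v" by (simp add: weight_eq)
  have "exp (- ((v - (2 * a + 2 * b - u))\<^sup>2) / 4) \<le> 1" by simp
  then have "2 * (exp (- ((v - (2 * a + 2 * b - u))\<^sup>2) / 4) / sqrt (4 * pi)) \<le> 2 * (1 / sqrt (4 * pi))"
    by (intro mult_left_mono divide_right_mono) auto
  then show "weight a b u v \<le> 2 / sqrt (4 * pi) * exp (b * (2 * a + b - 2 * u) / 2)"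
    unfolding weight_eq by (intro mult_right_mono) auto
qed

text \<open>The first identity recovers the joint density of the two endpoint gaps. In the second
  the walk goes from u to -v while the weight is still taken at v, so the exponent changes by
  -((u+v)^2 - (v-u)^2)/4 = -uv.\<close>

lemma weight_times_density:
  "normal_density 0 (sqrt 2) (v - u) * weight a b u v = phi (a - u) * phi (a + b - v)"
  "normal_density 0 (sqrt 2) (- u - v) * weight a b u v = phi (a - u) * phi (a + b - v) * exp (- (u * v))"
proof -
  have s: "2 * (1 / sqrt (4 * pi)) * (1 / sqrt (4 * pi)) = (1 / sqrt (2 * pi)) * (1 / sqrt (2 * pi))"
    by (simp add: field_simps)
  have n: "normal_density 0 (sqrt 2) z = 1 / sqrt (4 * pi) * exp (- (z\<^sup>2) / 4)" for z
    by (simp add: normal_density_def)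
  have *: "normal_density 0 (sqrt 2) z * weight a b u v =
     (2 * (1 / sqrt (4 * pi)) * (1 / sqrt (4 * pi))) * exp (- (z\<^sup>2) / 4 + - ((2 * a + b - u - v)\<^sup>2) / 4 + (b * (v - u) / 2 - b\<^sup>2 / 4))" for z
    unfolding weight_def n exp_add by (simp only: mult_ac)
  have **: "phi (a - u) * phi (a + b - v) * exp r = (1 / sqrt (2 * pi)) * (1 / sqrt (2 * pi)) * exp (- ((a - u)\<^sup>2) / 2 + - ((a + b - v)\<^sup>2) / 2 + r)" for r
    unfolding phi_def exp_add by simp
  have "- ((v - u)\<^sup>2) / 4 + - ((2 * a + b - u - v)\<^sup>2) / 4 + (b * (v - u) / 2 - b\<^sup>2 / 4) = - ((a - u)\<^sup>2) / 2 + - ((a + b - v)\<^sup>2) / 2 + 0"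
    by (simp add: field_simps power2_eq_square)
  then show "normal_density 0 (sqrt 2) (v - u) * weight a b u v = phi (a - u) * phi (a + b - v)"
    unfolding * s using **[of 0] by simp
  have "- ((- u - v)\<^sup>2) / 4 + - ((2 * a + b - u - v)\<^sup>2) / 4 + (b * (v - u) / 2 - b\<^sup>2 / 4) = - ((a - u)\<^sup>2) / 2 + - ((a + b - v)\<^sup>2) / 2 + - (u * v)"
    by (simp add: field_simps power2_eq_square)
  then show "normal_density 0 (sqrt 2) (- u - v) * weight a b u v = phi (a - u) * phi (a + b - v) * exp (- (u * v))"
    unfolding * s ** by (simp only:)
qed

section \<open>From dyadic grids to continuous time\<close>

context brownian_motion
begin

text \<open>The second claim keeps only the constraint at the endpoint; its bound does not depend on
  m and dominates the later integration over u.\<close>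

lemma survival_limit_weight:
  assumes u: "0 \<le> u"
  shows "(\<lambda>m. \<integral>\<^sup>+\<omega>. ennreal (weight a b u (u + X 1 \<omega>)) * indicator {\<omega>. \<forall>k\<in>{..2 ^ m}. 0 \<le> u + X (real k / 2 ^ m) \<omega>} \<omega> \<partial>M)
    \<longlonglongrightarrow> ennreal (phi (a - u) * Phi (a + b)) -
      (\<integral>\<^sup>+v. ennreal (phi (a - u) * phi (a + b - v) * exp (- (u * v))) * indicator {0..} v \<partial>lborel)"
    and "(\<integral>\<^sup>+\<omega>. ennreal (weight a b u (u + X 1 \<omega>)) * indicator {\<omega>. \<forall>k\<in>{..2 ^ m}. 0 \<le> u + X (real k / 2 ^ m) \<omega>} \<omega> \<partial>M)
      \<le> ennreal (phi (a - u) * Phi (a + b))"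
proof -
  let ?p = "normal_density 0 (sqrt 2)"
  define gp where "gp v = ennreal (weight a b u v) * indicator {0..} v" for v
  have w[measurable]: "weight a b u \<in> borel_measurable borel"
    unfolding weight_def[abs_def] by measurable
  have gp[measurable]: "gp \<in> borel_measurable borel" unfolding gp_def[abs_def] by measurable
  have "(\<integral>\<^sup>+\<omega>. gp (u + X 1 \<omega>) \<partial>M) = (\<integral>\<^sup>+x. ennreal (?p x) * gp (u + x) \<partial>lborel)"
    by (subst distributed_nn_integral[OF X1_normal]) auto
  also have "\<dots> = (\<integral>\<^sup>+v. ennreal (?p (v - u)) * gp v \<partial>lborel)"
    by (subst nn_integral_real_affine[where c=1 and t="-u"]) (auto simp: algebra_simps)
  also have "\<dots> = (\<integral>\<^sup>+v. ennreal (phi (a - u)) * (ennreal (phi (a + b - v)) * indicator {0..} v) \<partial>lborel)"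
    by (intro nn_integral_cong)
      (simp add: gp_def mult.assoc[symmetric] ennreal_mult[symmetric] weight_bounds weight_times_density)
  also have "\<dots> = ennreal (phi (a - u) * Phi (a + b))"
    by (subst nn_integral_cmult) (simp_all add: nn_integral_phi_shift ennreal_mult Phi_nonneg)
  finally have A: "(\<integral>\<^sup>+\<omega>. gp (u + X 1 \<omega>) \<partial>M) = ennreal (phi (a - u) * Phi (a + b))" .
  \<comment> \<open>The substitution x = -u - v turns the reflected endpoint -(u + x) into
    v.\<close>
  have "(\<integral>\<^sup>+\<omega>. gp (- (u + X 1 \<omega>)) \<partial>M) = (\<integral>\<^sup>+x. ennreal (?p x) * gp (- (u + x)) \<partial>lborel)"
    by (subst distributed_nn_integral[OF X1_normal]) auto
  also have "\<dots> = (\<integral>\<^sup>+v. ennreal (?p (- u - v)) * gp v \<partial>lborel)"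
    by (subst nn_integral_real_affine[where c="-1" and t="-u"]) auto
  also have "\<dots> = (\<integral>\<^sup>+v. ennreal (phi (a - u) * phi (a + b - v) * exp (- (u * v))) * indicator {0..} v \<partial>lborel)"
    by (intro nn_integral_cong)
      (simp add: gp_def mult.assoc[symmetric] ennreal_mult[symmetric] weight_bounds weight_times_density)
  finally have C: "(\<integral>\<^sup>+\<omega>. gp (- (u + X 1 \<omega>)) \<partial>M) = \<dots>" .
  have "continuous_on UNIV (weight a b u)"
    unfolding weight_def normal_density_def by (intro continuous_intros) auto
  from survival_limit[OF this weight_bounds u] A C
  show "(\<lambda>m. \<integral>\<^sup>+\<omega>. ennreal (weight a b u (u + X 1 \<omega>)) * indicator {\<omega>. \<forall>k\<in>{..2 ^ m}. 0 \<le> u + X (real k / 2 ^ m) \<omega>} \<omega> \<partial>M)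
    \<longlonglongrightarrow> ennreal (phi (a - u) * Phi (a + b)) -
      (\<integral>\<^sup>+v. ennreal (phi (a - u) * phi (a + b - v) * exp (- (u * v))) * indicator {0..} v \<partial>lborel)"
    unfolding gp_def by simp
  show "(\<integral>\<^sup>+\<omega>. ennreal (weight a b u (u + X 1 \<omega>)) * indicator {\<omega>. \<forall>k\<in>{..2 ^ m}. 0 \<le> u + X (real k / 2 ^ m) \<omega>} \<omega> \<partial>M)
      \<le> ennreal (phi (a - u) * Phi (a + b))"
    unfolding A[symmetric]
  proof (rule nn_integral_mono)
    fix \<omega>
    have "0 \<le> u + X 1 \<omega>" if "\<forall>k\<in>{..2 ^ m}. 0 \<le> u + X (real k / 2 ^ m) \<omega>"
      using that[rule_format, of "2 ^ m"] by simp
    then show "ennreal (weight a b u (u + X 1 \<omega>)) * indicator {\<omega>. \<forall>k\<in>{..2 ^ m}. 0 \<le> u + X (real k / 2 ^ m) \<omega>} \<omega> \<le> gp (u + X 1 \<omega>)"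
      by (auto simp: gp_def indicator_def)
  qed
qed

text \<open>Dyadic grids are nested, so the events decrease in m and their measures converge to that
  of the intersection, which path continuity identifies with the event over all of [0,1].\<close>

lemma emeasure_slepian_le:
  "(\<lambda>m. emeasure M {\<omega> \<in> space M. \<forall>k\<in>{..2 ^ m}. B (real k / 2 ^ m + 1) \<omega> - B (real k / 2 ^ m) \<omega> \<le> a + b * (real k / 2 ^ m)})
    \<longlonglongrightarrow> emeasure M {\<omega> \<in> space M. \<forall>t\<in>{0..1}. B (t + 1) \<omega> - B t \<omega> \<le> a + b * t}"
proof -
  define E where "E m = {\<omega> \<in> space M. \<forall>k\<in>{..2 ^ m}. B (real k / 2 ^ m + 1) \<omega> - B (real k / 2 ^ m) \<omega> \<le> a + b * (real k / 2 ^ m)}" for m :: nat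
  have E[measurable]: "E m \<in> sets M" for m
    unfolding E_def by measurable
  have "E (Suc m) \<subseteq> E m" for m
  proof
    fix \<omega> assume \<omega>: "\<omega> \<in> E (Suc m)"
    show "\<omega> \<in> E m"
      unfolding E_def
    proof (intro CollectI conjI ballI)
      show "\<omega> \<in> space M" using \<omega> by (simp add: E_def)
      fix k :: nat assume "k \<in> {..2 ^ m}"
      then have "2 * k \<in> {..2 ^ Suc m}" by simp
      then have "B (real (2 * k) / 2 ^ Suc m + 1) \<omega> - B (real (2 * k) / 2 ^ Suc m) \<omega> \<le> a + b * (real (2 * k) / 2 ^ Suc m)"
        using \<omega> unfolding E_def by blast
      moreover have "real (2 * k) / 2 ^ Suc m = real k / 2 ^ m" by simp
      ultimately show "B (real k / 2 ^ m + 1) \<omega> - B (real k / 2 ^ m) \<omega> \<le> a + b * (real k / 2 ^ m)"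
        by (simp only:)
    qed
  qed
  then have "decseq E" by (rule decseq_SucI)
  then have "(\<lambda>m. emeasure M (E m)) \<longlonglongrightarrow> emeasure M (\<Inter>m. E m)"
    by (intro Lim_emeasure_decseq) auto
  moreover have "(\<Inter>m. E m) = {\<omega> \<in> space M. \<forall>t\<in>{0..1}. B (t + 1) \<omega> - B t \<omega> \<le> a + b * t}"
  proof (intro equalityI subsetI)
    fix \<omega> assume \<omega>: "\<omega> \<in> (\<Inter>m. E m)"
    then have sp: "\<omega> \<in> space M" by (auto simp: E_def)
    show "\<omega> \<in> {\<omega> \<in> space M. \<forall>t\<in>{0..1}. B (t + 1) \<omega> - B t \<omega> \<le> a + b * t}"
    proof (intro CollectI conjI ballI sp)
      fix t :: real assume t: "t \<in> {0..1}"
      \<comment> \<open>Dyadic approximation from below: k m / 2^m stays at or below t \<le> 1, so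
        it is always a grid point of level m.\<close>
      define k where "k m = nat \<lfloor>t * 2 ^ m\<rfloor>" for m :: nat
      have kle: "real (k m) \<le> t * 2 ^ m" and kgt: "t * 2 ^ m - 1 \<le> real (k m)" for m
        using t unfolding k_def by (auto simp: of_nat_nat)
      have k1: "real (k m) / 2 ^ m \<le> t" for m
        using kle[of m] by (simp add: pos_divide_le_eq)
      have k2: "t - (1/2) ^ m \<le> real (k m) / 2 ^ m" for m
      proof -
        have "t - (1/2) ^ m = (t * 2 ^ m - 1) / 2 ^ m"
          by (simp add: diff_divide_distrib power_one_over)
        then show ?thesis using kgt[of m] by (simp add: divide_right_mono)
      qed
      have "(\<lambda>m. t - (1/2::real) ^ m) \<longlonglongrightarrow> t - 0"
        by (intro tendsto_intros) simp
      then have "(\<lambda>m. t - (1/2::real) ^ m) \<longlonglongrightarrow> t" by (simp only: diff_zero)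
      then have lim: "(\<lambda>m. real (k m) / 2 ^ m) \<longlonglongrightarrow> t"
        by (intro tendsto_sandwich[OF always_eventually[OF allI, OF k2] always_eventually[OF allI, OF k1] _ tendsto_const])
      have cont: "continuous_on {0..1} (\<lambda>t. B (t + 1) \<omega> - B t \<omega>)"
        by (intro continuous_intros continuous_on_compose2[OF continuous_path[OF sp]]) auto
      have in01: "real (k m) / 2 ^ m \<in> {0..1}" for m
        using order_trans[OF k1[of m], of 1] t by simp
      have "(\<lambda>m. B (real (k m) / 2 ^ m + 1) \<omega> - B (real (k m) / 2 ^ m) \<omega>) \<longlonglongrightarrow> B (t + 1) \<omega> - B t \<omega>"
        using continuous_on_tendsto_compose[OF cont lim] t in01 by simp
      moreover have "(\<lambda>m. a + b * (real (k m) / 2 ^ m)) \<longlonglongrightarrow> a + b * t"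
        by (intro tendsto_intros lim)
      moreover have "B (real (k m) / 2 ^ m + 1) \<omega> - B (real (k m) / 2 ^ m) \<omega> \<le> a + b * (real (k m) / 2 ^ m)" for m
      proof -
        have "real (k m) \<le> 2 ^ m" using in01[of m] by simp
        then have "k m \<in> {..2 ^ m}" by (metis atMost_iff of_nat_le_iff of_nat_numeral of_nat_power)
        moreover have "\<omega> \<in> E m" using \<omega> by blast
        ultimately show ?thesis unfolding E_def by blast
      qed
      ultimately show "B (t + 1) \<omega> - B t \<omega> \<le> a + b * t"
        by (blast intro: LIMSEQ_le)
    qed
  next
    fix \<omega> assume \<omega>: "\<omega> \<in> {\<omega> \<in> space M. \<forall>t\<in>{0..1}. B (t + 1) \<omega> - B t \<omega> \<le> a + b * t}"
    have "real k / 2 ^ m \<in> {0..1}" if "k \<in> {..2 ^ m}" for k m :: nat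
    proof -
      have "real k \<le> 2 ^ m" using that by (metis atMost_iff of_nat_le_iff of_nat_numeral of_nat_power)
      then show ?thesis by simp
    qed
    with \<omega> show "\<omega> \<in> (\<Inter>m. E m)" unfolding E_def by blast
  qed
  ultimately show ?thesis unfolding E_def by simp
qed

end

theorem theorem3p4:
  fixes M :: "'a measure" and B :: "real \<Rightarrow> 'a \<Rightarrow> real" and a b :: real
  assumes "std_brownian_motion M B" and "b \<noteq> 0"
  shows "measure M {\<omega> \<in> space M. \<forall>t\<in>{0..1}. B (t + 1) \<omega> - B t \<omega> \<le> a + b * t}
    = Phi (a + b) * Phi a - (1 / b) * phi a * Phi (a + b)
      + (sqrt (2 * pi) / b) * phi a * phi b * Phi a * exp (- (a * b))"
proof -
  interpret brownian_motion M B by standard (rule assms)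
  \<comment> \<open>For each start u, \<open>J m\<close> is the surviving mass on the grid of level
    m, \<open>A\<close> the mass constrained only at the endpoints, and \<open>C\<close> the
    limiting reflected mass.\<close>
  define J where "J m u = (\<integral>\<^sup>+\<omega>. ennreal (weight a b u (u + X 1 \<omega>)) * indicator {\<omega>. \<forall>k\<in>{..2 ^ m}. 0 \<le> u + X (real k / 2 ^ m) \<omega>} \<omega> \<partial>M)" for m :: nat and u
  define A where "A u = ennreal (phi (a - u) * Phi (a + b)) * indicator {0..} u" for u
  define C where "C u = (\<integral>\<^sup>+v. ennreal (phi (a - u) * phi (a + b - v) * exp (- (u * v))) * indicator {0..} v \<partial>lborel) * indicator {0..} u" for u
  define K where "K = (phi a * Phi (a + b) - phi (a + b) * Phi a) / b"
  have [measurable]: "J m \<in> borel_measurable borel" for m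
  proof -
    have "(\<lambda>(u, \<omega>). ennreal (weight a b u (u + X 1 \<omega>)) * indicator {\<omega>. \<forall>k\<in>{..2 ^ m}. 0 \<le> u + X (real k / 2 ^ m) \<omega>} \<omega>) \<in> borel_measurable (lborel \<Otimes>\<^sub>M M)"
      unfolding indicator_def weight_def by measurable
    from borel_measurable_nn_integral_fst[OF this] show ?thesis
      unfolding J_def[abs_def] by simp
  qed
  have [measurable]: "A \<in> borel_measurable borel" unfolding A_def[abs_def] by measurable
  have [measurable]: "C \<in> borel_measurable borel" unfolding C_def[abs_def] by measurable
  have intA: "(\<integral>\<^sup>+u. A u \<partial>lborel) = ennreal (Phi (a + b) * Phi a)"
  proof -
    have "(\<integral>\<^sup>+u. A u \<partial>lborel) = (\<integral>\<^sup>+u. ennreal (Phi (a + b)) * (ennreal (phi (a - u)) * indicator {0..} u) \<partial>lborel)"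
      unfolding A_def by (intro nn_integral_cong) (simp add: ennreal_mult Phi_nonneg mult_ac)
    also have "\<dots> = ennreal (Phi (a + b) * Phi a)"
      by (subst nn_integral_cmult) (simp_all add: nn_integral_phi_shift ennreal_mult Phi_nonneg)
    finally show ?thesis .
  qed
  have intC: "(\<integral>\<^sup>+u. C u \<partial>lborel) = ennreal K" and K: "0 \<le> K"
    using quadrant_integral[OF assms(2), of a] unfolding C_def K_def by auto
  \<comment> \<open>On the quadrant exp(-uv) \<le> 1. This ordering lets the integral of the
    \<open>ennreal\<close> difference be split, and later gives K \<le> Phi (a + b) * Phi a.\<close>
  have CA: "C u \<le> A u" for u
  proof (cases "0 \<le> u")
    case True
    have "(\<integral>\<^sup>+v. ennreal (phi (a - u) * phi (a + b - v) * exp (- (u * v))) * indicator {0..} v \<partial>lborel)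
      \<le> (\<integral>\<^sup>+v. ennreal (phi (a - u)) * (ennreal (phi (a + b - v)) * indicator {0..} v) \<partial>lborel)"
    proof (rule nn_integral_mono)
      fix v :: real
      show "ennreal (phi (a - u) * phi (a + b - v) * exp (- (u * v))) * indicator {0..} v \<le> ennreal (phi (a - u)) * (ennreal (phi (a + b - v)) * indicator {0..} v)"
      proof (cases "0 \<le> v")
        case v: True
        have "phi (a - u) * phi (a + b - v) * exp (- (u * v)) \<le> phi (a - u) * phi (a + b - v) * 1"
          using True v by (intro mult_left_mono) auto
        then show ?thesis using v by (simp add: ennreal_mult[symmetric] ennreal_leI)
      qed simp
    qed
    also have "\<dots> = ennreal (phi (a - u) * Phi (a + b))"
      by (subst nn_integral_cmult) (simp_all add: nn_integral_phi_shift ennreal_mult Phi_nonneg)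
    finally show ?thesis using True unfolding A_def C_def by simp
  qed (simp add: C_def)
  \<comment> \<open>The grid contains k = 0, where X vanishes, so a negative start never survives;
    this is what confines u to the half-line.\<close>
  have J0: "J m u = 0" if "u < 0" for m u
  proof -
    have "\<not> (\<forall>k\<in>{..2 ^ m}. 0 \<le> u + X (real k / 2 ^ m) \<omega>)" for \<omega>
      using that by (auto intro!: bexI[of _ 0])
    then show ?thesis unfolding J_def by simp
  qed
  have "(\<lambda>m. \<integral>\<^sup>+u. J m u \<partial>lborel) \<longlonglongrightarrow> (\<integral>\<^sup>+u. A u - C u \<partial>lborel)"
  proof (rule nn_integral_dominated_convergence[where w=A])
    show "AE u in lborel. J m u \<le> A u" for m
    proof (rule AE_I2)
      fix u show "J m u \<le> A u"
        using survival_limit_weight(2)[of u a b m] J0[of u m] unfolding J_def A_def by (cases "0 \<le> u") auto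
    qed
    show "(\<integral>\<^sup>+u. A u \<partial>lborel) < \<infinity>" unfolding intA by simp
    show "AE u in lborel. (\<lambda>m. J m u) \<longlonglongrightarrow> A u - C u"
    proof (rule AE_I2)
      fix u show "(\<lambda>m. J m u) \<longlonglongrightarrow> A u - C u"
        using survival_limit_weight(1)[of u a b] J0[of u] unfolding J_def A_def C_def by (cases "0 \<le> u") auto
    qed
  qed measurable
  moreover have "(\<integral>\<^sup>+u. A u - C u \<partial>lborel) = ennreal (Phi (a + b) * Phi a) - ennreal K"
    using CA by (subst nn_integral_diff) (auto simp: intA intC)
  moreover have "emeasure M {\<omega> \<in> space M. \<forall>k\<in>{..2 ^ m}. B (real k / 2 ^ m + 1) \<omega> - B (real k / 2 ^ m) \<omega> \<le> a + b * (real k / 2 ^ m)} = (\<integral>\<^sup>+u. J m u \<partial>lborel)" for m :: nat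
    using grid_probability[of "2 ^ m" a b] unfolding J_def by simp
  ultimately have "emeasure M {\<omega> \<in> space M. \<forall>t\<in>{0..1}. B (t + 1) \<omega> - B t \<omega> \<le> a + b * t} = ennreal (Phi (a + b) * Phi a - K)"
    using emeasure_slepian_le[of a b] K by (simp add: ennreal_minus LIMSEQ_unique)
  \<comment> \<open>Without this, \<open>ennreal\<close> of the difference would be truncated at
    zero and could not be turned back into a real number.\<close>
  moreover have "K \<le> Phi (a + b) * Phi a"
  proof -
    have "ennreal K \<le> ennreal (Phi (a + b) * Phi a)"
      unfolding intA[symmetric] intC[symmetric] by (intro nn_integral_mono CA)
    then show ?thesis by (simp add: Phi_nonneg)
  qed
  ultimately have "measure M {\<omega> \<in> space M. \<forall>t\<in>{0..1}. B (t + 1) \<omega> - B t \<omega> \<le> a + b * t} = Phi (a + b) * Phi a - K"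
    by (simp add: measure_def)
  also have "\<dots> = Phi (a + b) * Phi a - (1 / b) * phi a * Phi (a + b)
      + (sqrt (2 * pi) / b) * phi a * phi b * Phi a * exp (- (a * b))"
    unfolding K_def phi_add using assms(2) by (simp add: field_simps)
  finally show ?thesis .
qed

end
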